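(* Let $0\le m\le M-1$ and let $(\vec U^{m+1},\vec X^{m+1},\kappa^{m+1})\in\mathbb U^m_0\times\underline V(\Gamma^m)\times W(\Gamma^m)$ be the unique solution to the reduced discrete system, and $\Gamma^{m+1}=\vec X^{m+1}(\Gamma^m)$. Then $$\gamma\,\mathcal H^{d-1}(\Gamma^{m+1})+2\,\tau_m\left(\mu^m\underline{\underline D}(\vec U^{m+1}),\underline{\underline D}(\vec U^{m+1})\right)\le\gamma\,\mathcal H^{d-1}(\Gamma^m)+\tau_m\left(\vec f^{m+1},\vec U^{m+1}\right).$$ In addition, for an arbitrary partitioning $\{t_k\}_{k=0}^M$ of $[0,T]$, with $(\vec U^{k+1},\vec X^{k+1},\kappa^{k+1})$ the solutions at the successive time levels and $\Gamma^{k+1}=\vec X^{k+1}(\Gamma^k)$, it holds for $m=0,\ldots,M-1$ that $$\gamma\,\mathcal H^{d-1}(\Gamma^{m+1})+2\sum_{k=0}^m\tau_k\left(\mu^k\underline{\underline D}(\vec U^{k+1}),\underline{\underline D}(\vec U^{k+1})\right)\le\gamma\,\mathcal H^{d-1}(\Gamma^0)+\sum_{k=0}^m\tau_k\left(\vec f^{k+1},\vec U^{k+1}\right).$$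
   Context: Bulk. $d\in\{2,3\}$, $\Omega\subset\mathbb R^d$ is a bounded polyhedral domain, $0=t_0<\dots<t_M=T$, $\tau_m=t_{m+1}-t_m>0$. For each $m$, $\mathcal T^m$ is a regular partitioning of $\Omega$ into disjoint open simplices. $S^m_k$ ($k\ge1$) is the space of continuous functions on $\overline\Omega$ that are polynomials of degree at most $k$ on each simplex of $\mathcal T^m$; $S^m_0$ is the space of piecewise constants. $\mathbb U^m\subset H^1_0(\Omega,\mathbb R^d)$ and $\mathbb P^m\subset L^2(\Omega)$ are finite element spaces on $\mathcal T^m$ (finite-dimensional, $\mathbb U^m$ consisting of continuous functions), and $\widehat{\mathbb P}^m=\{\varphi\in\mathbb P^m:\int_\Omega\varphi=0\}$. $\mathbb U^m_0=\{\vec U\in\mathbb U^m:(\nabla\cdot\vec U,\varphi)=0\ \forall\varphi\in\widehat{\mathbb P}^m\}$. $(\cdot,\cdot)$ is the $L^2$ inner product on $\Omega$, $\underline{\underline D}(\vec u)=\frac12(\nabla\vec u+(\nabla\vec u)^T)$. Interface. $\Gamma^m=\bigcup_{j=1}^{J}\overline{\sigma^m_j}\subset\overline\Omega$ is a closed polyhedral surface without self-intersections: a union of mutually disjoint open non-degenerate $(d-1)$-simplices $\sigma^m_j$ with no hanging vertices. $\Omega^m_-$ is its interior, $\Omega^m_+$ its exterior (in $\Omega$), and $\vec\nu^m$ is the piecewise constant unit normal on $\Gamma^m$ pointing into $\Omega^m_+$. $W(\Gamma^m)$ is the space of scalar continuous functions on $\Gamma^m$ that are affine on each $\sigma^m_j$,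 and $\underline V(\Gamma^m)=[W(\Gamma^m)]^d$. $\vec X^m\in\underline V(\Gamma^m)$ is the identity function on $\Gamma^m$. $\langle v,w\rangle_{\Gamma^m}=\int_{\Gamma^m}v\cdot w\,d\mathcal H^{d-1}$, $\nabla_s$ is the surface gradient on $\Gamma^m$ (simplex by simplex), and the mass lumped product for piecewise continuous $v,w$ is $\langle v,w\rangle^h_{\Gamma^m}=\frac1d\sum_j\mathcal H^{d-1}(\sigma^m_j)\sum_{k=1}^d (v\cdot w)((\vec q^m_{j_k})^-)$, where $\vec q^m_{j_1},\dots,\vec q^m_{j_d}$ are the vertices of $\sigma^m_j$ and $(\cdot)^-$ denotes the limit from within $\sigma^m_j$. Data. $\gamma>0$, $\mu_\pm>0$; $\mu^m\in S^m_0$ equals $\mu_-$ on elements contained in $\Omega^m_-$, $\mu_+$ on elements contained in $\Omega^m_+$, and $\frac12(\mu_-+\mu_+)$ on elements intersecting $\Gamma^m$. $\vec f^{m+1}\in[S^m_2]^d$ is the nodal interpolant of a given forcing $\vec f(\cdot,t_{m+1})$. Reduced discrete system: find $(\vec U^{m+1},\vec X^{m+1},\kappa^{m+1})\in\mathbb U^m_0\times\underline V(\Gamma^m)\times W(\Gamma^m)$ with (a) $2(\mu^m\underline{\underline D}(\vec U^{m+1}),\underline{\underline D}(\vec\xi))-\gamma\langle\kappa^{m+1}\vec\nu^m,\vec\xi\rangle_{\Gamma^m}=(\vec f^{m+1},\vec\xi)$ for all $\vec\xi\in\mathbb U^m_0$; (c) $\big\langle\frac{\vec X^{m+1}-\vec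 X^m}{\tau_m},\chi\vec\nu^m\big\rangle^h_{\Gamma^m}-\langle\vec U^{m+1},\chi\vec\nu^m\rangle_{\Gamma^m}=0$ for all $\chi\in W(\Gamma^m)$; (d) $\langle\kappa^{m+1}\vec\nu^m,\vec\eta\rangle^h_{\Gamma^m}+\langle\nabla_s\vec X^{m+1},\nabla_s\vec\eta\rangle_{\Gamma^m}=0$ for all $\vec\eta\in\underline V(\Gamma^m)$. The next surface is $\Gamma^{m+1}=\vec X^{m+1}(\Gamma^m)$. *)

theory Defs
  imports "HOL-Analysis.Analysis"
begin

section \<open>Hausdorff measure\<close>

text \<open>Normalised so that the \<open>s\<close>-dimensional measure of a flat \<open>s\<close>-dimensional piece is its usual
  length (area, \<dots>).  Intended for \<open>s \<ge> 1\<close>: for \<open>s = 0\<close> the convention \<open>0 ^ 0 = 1\<close> would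
  charge empty sets.\<close>

definition hausdorff_delta :: "nat \<Rightarrow> real \<Rightarrow> 'a::metric_space set \<Rightarrow> ennreal" where
  "hausdorff_delta s \<delta> A =
     (INF C \<in> {C :: nat \<Rightarrow> 'a set. A \<subseteq> (\<Union>i. C i) \<and> (\<forall>i. bounded (C i) \<and> diameter (C i) \<le> \<delta>)}.
        \<Sum>i. ennreal (unit_ball_vol (real s) * (diameter (C i) / 2) ^ s))"

definition hausdorff_outer :: "nat \<Rightarrow> 'a::metric_space set \<Rightarrow> ennreal" where
  "hausdorff_outer s A = (SUP \<delta> \<in> {0<..}. hausdorff_delta s \<delta> A)"

definition hausdorff_measure :: "nat \<Rightarrow> 'a::metric_space measure" where
  "hausdorff_measure s = measure_of UNIV (sets borel) (hausdorff_outer s)"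


section \<open>Sobolev spaces\<close>

definition smooth :: "(real^'n \<Rightarrow> real) \<Rightarrow> bool" where
  "smooth \<phi> \<longleftrightarrow>
     (\<exists>D :: 'n list \<Rightarrow> real^'n \<Rightarrow> real. D [] = \<phi> \<and>
        (\<forall>l x. (D l has_derivative (\<lambda>h. \<Sum>i\<in>UNIV. h $ i * D (i # l) x)) (at x)))"

definition test_functions :: "(real^'n) set \<Rightarrow> (real^'n \<Rightarrow> real) set" where
  "test_functions \<Omega> =
     {\<phi>. smooth \<phi> \<and> compact (closure {x. \<phi> x \<noteq> 0}) \<and> closure {x. \<phi> x \<noteq> 0} \<subseteq> \<Omega>}"

definition classical_grad :: "(real^'n \<Rightarrow> real) \<Rightarrow> real^'n \<Rightarrow> real^'n" where
  "classical_grad \<phi> x = (\<chi> i. frechet_derivative \<phi> (at x) (axis i 1))"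

definition square_integrable_on ::
    "(real^'n) set \<Rightarrow> (real^'n \<Rightarrow> 'b::euclidean_space) \<Rightarrow> bool" where
  "square_integrable_on \<Omega> u \<longleftrightarrow>
     set_borel_measurable lebesgue \<Omega> u \<and> set_integrable lebesgue \<Omega> (\<lambda>x. (norm (u x))\<^sup>2)"

definition L2_inner ::
    "(real^'n) set \<Rightarrow> (real^'n \<Rightarrow> 'b::euclidean_space) \<Rightarrow> (real^'n \<Rightarrow> 'b) \<Rightarrow> real" where
  "L2_inner \<Omega> u v = (LINT x:\<Omega>|lebesgue. u x \<bullet> v x)"

definition weak_gradient ::
    "(real^'n) set \<Rightarrow> (real^'n \<Rightarrow> real) \<Rightarrow> (real^'n \<Rightarrow> real^'n) \<Rightarrow> bool" where
  "weak_gradient \<Omega> u G \<longleftrightarrow>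
     (\<forall>\<phi> \<in> test_functions \<Omega>. \<forall>i.
        (LINT x:\<Omega>|lebesgue. u x * classical_grad \<phi> x $ i) = - (LINT x:\<Omega>|lebesgue. G x $ i * \<phi> x))"

definition H1 :: "(real^'n) set \<Rightarrow> (real^'n \<Rightarrow> real) set" where
  "H1 \<Omega> = {u. square_integrable_on \<Omega> u \<and>
              (\<exists>G. square_integrable_on \<Omega> G \<and> weak_gradient \<Omega> u G)}"

text \<open>For \<open>u \<in> H1 \<Omega>\<close> this is determined up to a Lebesgue null set.\<close>

definition grad :: "(real^'n) set \<Rightarrow> (real^'n \<Rightarrow> real) \<Rightarrow> real^'n \<Rightarrow> real^'n" where
  "grad \<Omega> u = (SOME G. square_integrable_on \<Omega> G \<and> weak_gradient \<Omega> u G)"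

definition H10 :: "(real^'n) set \<Rightarrow> (real^'n \<Rightarrow> real) set" where
  "H10 \<Omega> = {u \<in> H1 \<Omega>. \<exists>\<phi> :: nat \<Rightarrow> real^'n \<Rightarrow> real. (\<forall>k. \<phi> k \<in> test_functions \<Omega>) \<and>
     (\<lambda>k. (LINT x:\<Omega>|lebesgue. (u x - \<phi> k x)\<^sup>2) +
          (LINT x:\<Omega>|lebesgue. (norm (grad \<Omega> u x - classical_grad (\<phi> k) x))\<^sup>2)) \<longlonglongrightarrow> 0}"

definition vgrad :: "(real^'n) set \<Rightarrow> (real^'n \<Rightarrow> real^'n) \<Rightarrow> real^'n \<Rightarrow> real^'n^'n" where
  "vgrad \<Omega> u x = (\<chi> i. grad \<Omega> (\<lambda>y. u y $ i) x)"

definition divergence :: "(real^'n) set \<Rightarrow> (real^'n \<Rightarrow> real^'n) \<Rightarrow> real^'n \<Rightarrow> real" where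
  "divergence \<Omega> u x = trace (vgrad \<Omega> u x)"

definition rate_of_strain :: "(real^'n) set \<Rightarrow> (real^'n \<Rightarrow> real^'n) \<Rightarrow> real^'n \<Rightarrow> real^'n^'n" where
  "rate_of_strain \<Omega> u x = (1/2) *\<^sub>R (vgrad \<Omega> u x + transpose (vgrad \<Omega> u x))"


section \<open>Domain, bulk mesh and finite element spaces\<close>

definition polyhedral_domain :: "(real^'n) set \<Rightarrow> bool" where
  "polyhedral_domain \<Omega> \<longleftrightarrow>
     open \<Omega> \<and> connected \<Omega> \<and> \<Omega> \<noteq> {} \<and> bounded \<Omega> \<and>
     (\<exists>F. finite F \<and> (\<forall>P\<in>F. polytope P \<and> aff_dim P = int CARD('n) - 1) \<and> frontier \<Omega> = \<Union>F)"

text \<open>A partitioning is given by the set of its closed simplices; the open simplices are their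
  interiors.  The library's \<^const>\<open>triangulation\<close> (finitely many simplices, any two meeting in a
  common face) makes the open simplices pairwise disjoint and excludes hanging vertices.\<close>

definition regular_partitioning :: "(real^'n) set \<Rightarrow> (real^'n) set set \<Rightarrow> bool" where
  "regular_partitioning \<Omega> \<T> \<longleftrightarrow>
     triangulation \<T> \<and> (\<forall>K\<in>\<T>. int CARD('n) simplex K \<and> interior K \<subseteq> \<Omega>) \<and> \<Union>\<T> = closure \<Omega>"

definition polys :: "nat \<Rightarrow> (real^'n \<Rightarrow> real) set" where
  "polys k = {p. \<exists>c :: ('n \<Rightarrow> nat) \<Rightarrow> real.
     p = (\<lambda>x. \<Sum>a | (\<Sum>i\<in>UNIV. a i) \<le> k. c a * (\<Prod>i\<in>UNIV. x $ i ^ a i))}"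

definition piecewise_poly :: "(real^'n) set set \<Rightarrow> nat \<Rightarrow> (real^'n \<Rightarrow> real) \<Rightarrow> bool" where
  "piecewise_poly \<T> k u \<longleftrightarrow> (\<forall>K\<in>\<T>. \<exists>p\<in>polys k. \<forall>x\<in>interior K. u x = p x)"

text \<open>The space \<open>S_k\<close> of continuous piecewise polynomials (\<open>k \<ge> 1\<close>).\<close>

definition lagrange_space :: "(real^'n) set \<Rightarrow> (real^'n) set set \<Rightarrow> nat \<Rightarrow> (real^'n \<Rightarrow> real) set" where
  "lagrange_space \<Omega> \<T> k = {u. continuous_on (closure \<Omega>) u \<and> piecewise_poly \<T> k u}"

text \<open>The nodes of \<open>S_2\<close>: all vertices (\<open>a = b\<close>) and edge midpoints.\<close>

definition quadratic_nodes :: "(real^'n) set set \<Rightarrow> (real^'n) set" where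
  "quadratic_nodes \<T> =
     {midpoint a b | a b. \<exists>K\<in>\<T>. a extreme_point_of K \<and> b extreme_point_of K}"

definition quadratic_interpolant ::
    "(real^'n) set \<Rightarrow> (real^'n) set set \<Rightarrow> (real^'n \<Rightarrow> real^'n) \<Rightarrow> (real^'n \<Rightarrow> real^'n) \<Rightarrow> bool" where
  "quadratic_interpolant \<Omega> \<T> g F \<longleftrightarrow>
     (\<forall>i. (\<lambda>x. F x $ i) \<in> lagrange_space \<Omega> \<T> 2) \<and> (\<forall>q\<in>quadratic_nodes \<T>. F q = g q)"

definition fin_dim_space :: "(real^'n) set set \<Rightarrow> (real^'n \<Rightarrow> 'b::real_vector) set \<Rightarrow> bool" where
  "fin_dim_space \<T> V \<longleftrightarrow>
     (\<lambda>x. 0) \<in> V \<and> (\<forall>u\<in>V. \<forall>v\<in>V. (\<lambda>x. u x + v x) \<in> V) \<and> (\<forall>a. \<forall>v\<in>V. (\<lambda>x. a *\<^sub>R v x) \<in> V) \<and>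
     (\<exists>B. finite B \<and> B \<subseteq> V \<and>
        (\<forall>v\<in>V. \<exists>c. \<forall>K\<in>\<T>. \<forall>x\<in>interior K. v x = (\<Sum>b\<in>B. c b *\<^sub>R b x)))"

definition velocity_space ::
    "(real^'n) set \<Rightarrow> (real^'n) set set \<Rightarrow> (real^'n \<Rightarrow> real^'n) set \<Rightarrow> bool" where
  "velocity_space \<Omega> \<T> \<U> \<longleftrightarrow>
     fin_dim_space \<T> \<U> \<and>
     (\<forall>u\<in>\<U>. continuous_on (closure \<Omega>) u \<and>
        (\<forall>i. (\<lambda>x. u x $ i) \<in> H10 \<Omega> \<and> (\<exists>k. piecewise_poly \<T> k (\<lambda>x. u x $ i))))"

definition pressure_space ::
    "(real^'n) set \<Rightarrow> (real^'n) set set \<Rightarrow> (real^'n \<Rightarrow> real) set \<Rightarrow> bool" where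
  "pressure_space \<Omega> \<T> \<P> \<longleftrightarrow>
     fin_dim_space \<T> \<P> \<and>
     (\<forall>p\<in>\<P>. square_integrable_on \<Omega> p \<and> (\<exists>k. piecewise_poly \<T> k p))"

definition zero_mean :: "(real^'n) set \<Rightarrow> (real^'n \<Rightarrow> real) set \<Rightarrow> (real^'n \<Rightarrow> real) set" where
  "zero_mean \<Omega> \<P> = {p\<in>\<P>. (LINT x:\<Omega>|lebesgue. p x) = 0}"

definition div_free_space ::
    "(real^'n) set \<Rightarrow> (real^'n \<Rightarrow> real^'n) set \<Rightarrow> (real^'n \<Rightarrow> real) set \<Rightarrow> (real^'n \<Rightarrow> real^'n) set" where
  "div_free_space \<Omega> \<U> \<P> = {u\<in>\<U>. \<forall>p\<in>zero_mean \<Omega> \<P>. L2_inner \<Omega> (divergence \<Omega> u) p = 0}"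


section \<open>Polyhedral surfaces\<close>

text \<open>A surface is given by the set \<open>S\<close> of its closed simplices; the open simplices are
  their relative interiors, and the surface itself is \<open>\<Union>S\<close>.  Closedness and absence of
  self-intersections: \<open>\<Union>S\<close> is compact and an embedded topological hypersurface without
  boundary.\<close>

definition closed_polyhedral_surface :: "(real^'n) set set \<Rightarrow> bool" where
  "closed_polyhedral_surface S \<longleftrightarrow>
     S \<noteq> {} \<and> triangulation S \<and> (\<forall>K\<in>S. (int CARD('n) - 1) simplex K) \<and>
     (\<forall>x\<in>\<Union>S. \<exists>V H :: (real^'n) set. openin (top_of_set (\<Union>S)) V \<and> x \<in> V \<and>
        subspace H \<and> dim H = CARD('n) - 1 \<and> V homeomorphic H)"

text \<open>\<open>H^(d-1)\<close> as a real number; a length for \<open>d = 2\<close>.\<close>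

definition area :: "(real^'n) set \<Rightarrow> real" where
  "area A = measure (hausdorff_measure (CARD('n) - 1)) A"

definition tangent_space :: "(real^'n) set \<Rightarrow> (real^'n) set" where
  "tangent_space K = span {x - y | x y. x \<in> K \<and> y \<in> K}"

text \<open>"Pointing into the exterior" is expressed through the exterior \<^const>\<open>outside\<close> in the whole
  space, not its part in \<open>\<Omega>\<close>: for simplices inside \<open>\<Omega>\<close> this is the same, and it
  remains meaningful for simplices lying on the boundary of \<open>\<Omega>\<close>.\<close>

definition simplex_normal :: "(real^'n) set set \<Rightarrow> (real^'n) set \<Rightarrow> real^'n" where
  "simplex_normal S K = (THE v. norm v = 1 \<and> (\<forall>w\<in>tangent_space K. v \<bullet> w = 0) \<and>
     (\<forall>x\<in>rel_interior K. \<exists>\<epsilon>>0. \<forall>r. 0 < r \<and> r < \<epsilon> \<longrightarrow> x + r *\<^sub>R v \<in> outside (\<Union>S)))"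

text \<open>Quantities defined simplex by simplex are set to \<open>0\<close> on the (null) union of the relative
  boundaries.\<close>

definition normal :: "(real^'n) set set \<Rightarrow> real^'n \<Rightarrow> real^'n" where
  "normal S x = (\<Sum>K\<in>S. indicator (rel_interior K) x *\<^sub>R simplex_normal S K)"

definition tangential_grad :: "(real^'n) set \<Rightarrow> (real^'n \<Rightarrow> real) \<Rightarrow> real^'n \<Rightarrow> real^'n" where
  "tangential_grad K f x =
     (THE g. g \<in> tangent_space K \<and> (f has_derivative (\<lambda>h. g \<bullet> h)) (at x within K))"

definition surface_grad :: "(real^'n) set set \<Rightarrow> (real^'n \<Rightarrow> real^'n) \<Rightarrow> real^'n \<Rightarrow> real^'n^'n" where
  "surface_grad S f x =
     (\<Sum>K\<in>S. indicator (rel_interior K) x *\<^sub>R (\<chi> i. tangential_grad K (\<lambda>y. f y $ i) x))"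

definition W_space :: "(real^'n) set set \<Rightarrow> (real^'n \<Rightarrow> real) set" where
  "W_space S = {f. continuous_on (\<Union>S) f \<and> (\<forall>K\<in>S. \<exists>a b. \<forall>x\<in>rel_interior K. f x = a \<bullet> x + b)}"

definition V_space :: "(real^'n) set set \<Rightarrow> (real^'n \<Rightarrow> real^'n) set" where
  "V_space S = {f. \<forall>i. (\<lambda>x. f x $ i) \<in> W_space S}"

definition surface_inner ::
    "(real^'n) set set \<Rightarrow> (real^'n \<Rightarrow> 'b::euclidean_space) \<Rightarrow> (real^'n \<Rightarrow> 'b) \<Rightarrow> real" where
  "surface_inner S v w = (LINT x:\<Union>S|hausdorff_measure (CARD('n) - 1). v x \<bullet> w x)"

definition lumped_inner ::
    "(real^'n) set set \<Rightarrow> (real^'n \<Rightarrow> 'b::euclidean_space) \<Rightarrow> (real^'n \<Rightarrow> 'b) \<Rightarrow> real" where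
  "lumped_inner S v w =
     (1 / real CARD('n)) * (\<Sum>K\<in>S. area (rel_interior K) *
        (\<Sum>q | q extreme_point_of K. Lim (at q within rel_interior K) (\<lambda>x. v x \<bullet> w x)))"

text \<open>\<open>\<mu>\<^sub>m\<close> and \<open>\<mu>\<^sub>p\<close> are the viscosities in the interior and exterior phase.
  An open element contained in neither phase meets the surface, because it is connected.\<close>

definition viscosity ::
    "(real^'n) set \<Rightarrow> (real^'n) set set \<Rightarrow> (real^'n) set set \<Rightarrow> real \<Rightarrow> real \<Rightarrow> real^'n \<Rightarrow> real" where
  "viscosity \<Omega> \<T> S \<mu>\<^sub>m \<mu>\<^sub>p x =
     (\<Sum>K\<in>\<T>. indicator (interior K) x *
        (if interior K \<subseteq> \<Omega> \<inter> inside (\<Union>S) then \<mu>\<^sub>m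
         else if interior K \<subseteq> \<Omega> \<inter> outside (\<Union>S) then \<mu>\<^sub>p
         else (\<mu>\<^sub>m + \<mu>\<^sub>p) / 2))"


section \<open>The reduced discrete system\<close>

definition reduced_solution ::
    "(real^'n) set \<Rightarrow> (real^'n) set set \<Rightarrow> (real^'n \<Rightarrow> real^'n) set \<Rightarrow> (real^'n \<Rightarrow> real) set \<Rightarrow>
     (real^'n) set set \<Rightarrow> real \<Rightarrow> (real^'n \<Rightarrow> real) \<Rightarrow> real \<Rightarrow> (real^'n \<Rightarrow> real^'n) \<Rightarrow>
     (real^'n \<Rightarrow> real^'n) \<Rightarrow> (real^'n \<Rightarrow> real^'n) \<Rightarrow> (real^'n \<Rightarrow> real) \<Rightarrow> bool" where
  "reduced_solution \<Omega> \<T> \<U> \<P> S \<gamma> \<mu> \<tau> F U X \<kappa> \<longleftrightarrow>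
     U \<in> div_free_space \<Omega> \<U> \<P> \<and> X \<in> V_space S \<and> \<kappa> \<in> W_space S \<and>
     (\<forall>\<xi> \<in> div_free_space \<Omega> \<U> \<P>.
        2 * L2_inner \<Omega> (\<lambda>x. \<mu> x *\<^sub>R rate_of_strain \<Omega> U x) (rate_of_strain \<Omega> \<xi>)
          - \<gamma> * surface_inner S (\<lambda>x. \<kappa> x *\<^sub>R normal S x) \<xi> = L2_inner \<Omega> F \<xi>) \<and>
     (\<forall>\<zeta> \<in> W_space S.
        lumped_inner S (\<lambda>x. (X x - x) /\<^sub>R \<tau>) (\<lambda>x. \<zeta> x *\<^sub>R normal S x)
          - surface_inner S U (\<lambda>x. \<zeta> x *\<^sub>R normal S x) = 0) \<and>
     (\<forall>\<eta> \<in> V_space S.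
        lumped_inner S (\<lambda>x. \<kappa> x *\<^sub>R normal S x) \<eta>
          + surface_inner S (surface_grad S X) (surface_grad S \<eta>) = 0)"

text \<open>Functions are total, so uniqueness is equality on the respective domains of definition.\<close>

definition unique_reduced_solution ::
    "(real^'n) set \<Rightarrow> (real^'n) set set \<Rightarrow> (real^'n \<Rightarrow> real^'n) set \<Rightarrow> (real^'n \<Rightarrow> real) set \<Rightarrow>
     (real^'n) set set \<Rightarrow> real \<Rightarrow> (real^'n \<Rightarrow> real) \<Rightarrow> real \<Rightarrow> (real^'n \<Rightarrow> real^'n) \<Rightarrow>
     (real^'n \<Rightarrow> real^'n) \<Rightarrow> (real^'n \<Rightarrow> real^'n) \<Rightarrow> (real^'n \<Rightarrow> real) \<Rightarrow> bool" where
  "unique_reduced_solution \<Omega> \<T> \<U> \<P> S \<gamma> \<mu> \<tau> F U X \<kappa> \<longleftrightarrow>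
     reduced_solution \<Omega> \<T> \<U> \<P> S \<gamma> \<mu> \<tau> F U X \<kappa> \<and>
     (\<forall>U' X' \<kappa>'. reduced_solution \<Omega> \<T> \<U> \<P> S \<gamma> \<mu> \<tau> F U' X' \<kappa>' \<longrightarrow>
        (\<forall>x\<in>closure \<Omega>. U' x = U x) \<and> (\<forall>x\<in>\<Union>S. X' x = X x \<and> \<kappa>' x = \<kappa> x))"

end

theory Submission
  imports Defs
begin

text \<open>Testing the reduced system with \<open>\<xi> = U\<close>, \<open>\<zeta> = \<kappa>\<close> and \<open>\<eta> = X - id\<close> turns it into the energy
  identity \<open>2\<tau>(\<mu> D(U), D(U)) + \<gamma>\<langle>\<nabla>\<^sub>s X, \<nabla>\<^sub>s(X - id)\<rangle> = \<tau>(F, U)\<close>, so it remains to bound the surface term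
  from below by the increase in area.  On a single simplex \<open>X\<close> is affine and multiplies the area by
  \<open>\<bar>det M\<bar>\<close>, where \<open>M\<close> represents its linear part in orthonormal coordinates; for tangent dimension
  \<open>1\<close> or \<open>2\<close> one has \<open>\<bar>det M\<bar> - 1 \<le> (\<bar>M\<bar>\<^sup>2 - \<bar>I\<bar>\<^sup>2)/2 \<le> \<nabla>\<^sub>s X \<cdot> \<nabla>\<^sub>s(X - id)\<close>.  The scaling law for the
  Hausdorff measure needs no isodiametric inequality: being translation invariant, the measure is a
  constant multiple of Lebesgue measure on each tangent plane, and the constant cancels.\<close>

subsection \<open>Hausdorff outer measure\<close>

abbreviation hausdorff_weight :: "nat \<Rightarrow> 'a::metric_space set \<Rightarrow> ennreal" where
  "hausdorff_weight s C \<equiv> ennreal (unit_ball_vol (real s) * (diameter C / 2) ^ s)"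

abbreviation hausdorff_cover :: "real \<Rightarrow> 'a::metric_space set \<Rightarrow> (nat \<Rightarrow> 'a set) \<Rightarrow> bool" where
  "hausdorff_cover \<delta> A C \<equiv> A \<subseteq> (\<Union>i. C i) \<and> (\<forall>i. bounded (C i) \<and> diameter (C i) \<le> \<delta>)"

lemma hausdorff_weight_mono:
  assumes "diameter C \<le> r" "bounded C"
  shows "hausdorff_weight s C \<le> ennreal (unit_ball_vol (real s) * (r / 2) ^ s)"
proof -
  have "0 \<le> diameter C"
    using assms by (simp add: diameter_ge_0)
  then show ?thesis
    using assms by (intro ennreal_leI mult_left_mono power_mono) auto
qed

lemma hausdorff_delta_le:
  "hausdorff_cover \<delta> A C \<Longrightarrow> hausdorff_delta s \<delta> A \<le> (\<Sum>i. hausdorff_weight s (C i))"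
  unfolding hausdorff_delta_def by (rule INF_lower) simp

lemma hausdorff_delta_greatest:
  "(\<And>C. hausdorff_cover \<delta> A C \<Longrightarrow> r \<le> (\<Sum>i. hausdorff_weight s (C i))) \<Longrightarrow> r \<le> hausdorff_delta s \<delta> A"
  unfolding hausdorff_delta_def by (rule INF_greatest) simp

lemma hausdorff_delta_antimono: "\<delta> \<le> \<delta>' \<Longrightarrow> hausdorff_delta s \<delta>' A \<le> hausdorff_delta s \<delta> A"
  by (rule hausdorff_delta_greatest, rule hausdorff_delta_le) (meson order_trans)

lemma hausdorff_delta_subset: "A \<subseteq> B \<Longrightarrow> hausdorff_delta s \<delta> A \<le> hausdorff_delta s \<delta> B"
  by (rule hausdorff_delta_greatest, rule hausdorff_delta_le) blast

text \<open>The cover by empty sets costs nothing, since \<open>0 ^ s = 0\<close> for positive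
  \<open>s\<close>. This is also what later allows covers to be padded with empty sets.\<close>

lemma hausdorff_delta_empty:
  assumes "s > 0" "\<delta> \<ge> 0"
  shows "hausdorff_delta s \<delta> ({} :: 'a::metric_space set) = 0"
proof -
  have "hausdorff_delta s \<delta> ({} :: 'a set) \<le> (\<Sum>i::nat. hausdorff_weight s ({} :: 'a set))"
    using assms by (intro hausdorff_delta_le) auto
  also have "\<dots> = 0"
    using assms by (simp add: zero_power)
  finally show ?thesis
    by simp
qed

text \<open>Each \<open>A i\<close> has a cover that is optimal up to
  \<open>e * (1/2) ^ Suc i\<close>. The union of these covers is a countable cover of the union, and
  the errors add up to \<open>e\<close>.\<close>

lemma hausdorff_delta_countably_subadditive:
  "hausdorff_delta s \<delta> (\<Union>i. A i) \<le> (\<Sum>i. hausdorff_delta s \<delta> (A i))"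
proof (rule ennreal_le_epsilon)
  fix e :: real
  assume fin: "(\<Sum>i. hausdorff_delta s \<delta> (A i)) < top" and "0 < e"
  have "\<exists>C. hausdorff_cover \<delta> (A i) C \<and>
      (\<Sum>j. hausdorff_weight s (C j)) \<le> hausdorff_delta s \<delta> (A i) + e * (1/2) ^ Suc i" for i
  proof -
    have "hausdorff_delta s \<delta> (A i) < top"
      using fin ennreal_suminf_lessD by blast
    then have "hausdorff_delta s \<delta> (A i) < hausdorff_delta s \<delta> (A i) + e * (1/2) ^ Suc i"
      using \<open>0 < e\<close> by (simp add: ennreal_zero_less_mult_iff)
    then show ?thesis
      unfolding hausdorff_delta_def[of s \<delta> "A i"] INF_less_iff by (force intro: less_imp_le)
  qed
  then obtain C where C: "\<And>i. hausdorff_cover \<delta> (A i) (C i)"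
    and le: "\<And>i. (\<Sum>j. hausdorff_weight s (C i j)) \<le> hausdorff_delta s \<delta> (A i) + e * (1/2) ^ Suc i"
    by metis
  \<comment> \<open>The double sequence of covering sets is listed along the pairing bijection,
    which leaves the double sum unchanged.\<close>
  define D where "D = (\<lambda>n. C (fst (prod_decode n)) (snd (prod_decode n)))"
  have "hausdorff_cover \<delta> (\<Union>i. A i) D"
  proof (intro conjI allI subsetI)
    fix x assume "x \<in> (\<Union>i. A i)"
    then obtain i j where "x \<in> C i j"
      using C by blast
    then have "x \<in> D (prod_encode (i, j))"
      by (simp add: D_def)
    then show "x \<in> (\<Union>n. D n)"
      by blast
  qed (use C in \<open>auto simp: D_def\<close>)
  then have "hausdorff_delta s \<delta> (\<Union>i. A i) \<le> (\<Sum>n. hausdorff_weight s (D n))"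
    by (rule hausdorff_delta_le)
  also have "\<dots> = (\<Sum>n. (\<lambda>p. hausdorff_weight s (C (fst p) (snd p))) (prod_decode n))"
    by (simp add: D_def)
  also have "\<dots> = (\<Sum>i. \<Sum>j. hausdorff_weight s (C i j))"
    by (rule suminf_ennreal_2dimen) simp
  also have "\<dots> \<le> (\<Sum>i. hausdorff_delta s \<delta> (A i) + e * (1/2) ^ Suc i)"
    by (intro suminf_le le) auto
  also have "\<dots> = (\<Sum>i. hausdorff_delta s \<delta> (A i)) + (\<Sum>i. ennreal e * ennreal ((1/2) ^ Suc i))"
    using \<open>0 < e\<close> by (subst suminf_add[symmetric]) (auto simp del: ennreal_suminf_cmult simp add: ennreal_mult[symmetric])
  also have "\<dots> = (\<Sum>i. hausdorff_delta s \<delta> (A i)) + e"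
    unfolding ennreal_suminf_cmult by (subst suminf_ennreal_eq[OF zero_le_power power_half_series]) auto
  finally show "hausdorff_delta s \<delta> (\<Union>i. A i) \<le> (\<Sum>i. hausdorff_delta s \<delta> (A i)) + e" .
qed

lemma hausdorff_delta_le_outer: "\<delta> > 0 \<Longrightarrow> hausdorff_delta s \<delta> A \<le> hausdorff_outer s A"
  unfolding hausdorff_outer_def by (rule SUP_upper) simp

lemma hausdorff_outer_least: "(\<And>\<delta>. \<delta> > 0 \<Longrightarrow> hausdorff_delta s \<delta> A \<le> r) \<Longrightarrow> hausdorff_outer s A \<le> r"
  unfolding hausdorff_outer_def by (rule SUP_least) simp

lemma hausdorff_outer_subset: "A \<subseteq> B \<Longrightarrow> hausdorff_outer s A \<le> hausdorff_outer s B"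
  by (meson hausdorff_outer_least hausdorff_delta_le_outer hausdorff_delta_subset order_trans)

lemma hausdorff_outer_empty: "s > 0 \<Longrightarrow> hausdorff_outer s {} = 0"
  unfolding hausdorff_outer_def by (simp add: hausdorff_delta_empty)

lemma hausdorff_outer_countably_subadditive:
  "hausdorff_outer s (\<Union>i. A i) \<le> (\<Sum>i. hausdorff_outer s (A i))"
proof (rule hausdorff_outer_least)
  fix \<delta> :: real assume "\<delta> > 0"
  then show "hausdorff_delta s \<delta> (\<Union>i. A i) \<le> (\<Sum>i. hausdorff_outer s (A i))"
    by (intro order_trans[OF hausdorff_delta_countably_subadditive] suminf_le
        hausdorff_delta_le_outer) auto
qed

section \<open>Contractions, isometries and positively separated sets\<close>

text \<open>The image of a cover is a cover with no larger diameters. Its members are first cut down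
  to \<open>A\<close>, because \<open>f\<close> is controlled only there.\<close>

lemma hausdorff_outer_image_le:
  assumes "\<And>x y. x \<in> A \<Longrightarrow> y \<in> A \<Longrightarrow> dist (f x) (f y) \<le> dist x y"
  shows "hausdorff_outer s (f ` A) \<le> hausdorff_outer s A"
proof (rule hausdorff_outer_least)
  fix \<delta> :: real assume "\<delta> > 0"
  have "hausdorff_delta s \<delta> (f ` A) \<le> hausdorff_delta s \<delta> A"
  proof (rule hausdorff_delta_greatest)
    fix C assume C: "hausdorff_cover \<delta> A C"
    have bd: "bounded (f ` (C i \<inter> A)) \<and> diameter (f ` (C i \<inter> A)) \<le> diameter (C i)" for i
    proof -
      have bC: "bounded (C i)"
        using C by blast
      have d: "dist (f x) (f y) \<le> diameter (C i)" if "x \<in> C i \<inter> A" "y \<in> C i \<inter> A" for x y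
        using assms[of x y] diameter_bounded_bound[OF bC, of x y] that by force
      have "bounded (f ` (C i \<inter> A))"
        unfolding bounded_two_points using d by blast
      moreover have "diameter (f ` (C i \<inter> A)) \<le> diameter (C i)"
        unfolding diameter_def[of "f ` (C i \<inter> A)"] using d diameter_ge_0[OF bC]
        by (auto intro!: cSUP_least)
      ultimately show ?thesis ..
    qed
    have "hausdorff_delta s \<delta> (f ` A) \<le> (\<Sum>i. hausdorff_weight s (f ` (C i \<inter> A)))"
      using C bd by (intro hausdorff_delta_le) (fastforce intro: order_trans)
    also have "\<dots> \<le> (\<Sum>i. hausdorff_weight s (C i))"
      using bd by (intro suminf_le hausdorff_weight_mono) auto
    finally show "hausdorff_delta s \<delta> (f ` A) \<le> (\<Sum>i. hausdorff_weight s (C i))" .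
  qed
  also have "\<dots> \<le> hausdorff_outer s A"
    using \<open>\<delta> > 0\<close> by (rule hausdorff_delta_le_outer)
  finally show "hausdorff_delta s \<delta> (f ` A) \<le> hausdorff_outer s A" .
qed

lemma hausdorff_outer_isometric_image:
  assumes "\<And>x y. x \<in> A \<Longrightarrow> y \<in> A \<Longrightarrow> dist (f x) (f y) = dist x y"
  shows "hausdorff_outer s (f ` A) = hausdorff_outer s A"
proof (rule antisym)
  show "hausdorff_outer s (f ` A) \<le> hausdorff_outer s A"
    using assms by (intro hausdorff_outer_image_le) simp
  have inj: "inj_on f A"
    using assms by (metis dist_eq_0_iff inj_onI)
  have "hausdorff_outer s (inv_into A f ` f ` A) \<le> hausdorff_outer s (f ` A)"
    using assms inj by (intro hausdorff_outer_image_le) auto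
  then show "hausdorff_outer s A \<le> hausdorff_outer s (f ` A)"
    using inj by (simp add: image_image)
qed

text \<open>A set of diameter at most \<open>\<delta>\<close> cannot meet both \<open>A\<close> and
  \<open>B\<close>. Any cover of the union therefore splits into a cover of \<open>A\<close> and a
  cover of \<open>B\<close> that share no nonempty member.\<close>

lemma hausdorff_delta_separated:
  assumes "s > 0" "0 < \<delta>" "\<And>x y. x \<in> A \<Longrightarrow> y \<in> B \<Longrightarrow> \<delta> < dist x y"
  shows "hausdorff_delta s \<delta> A + hausdorff_delta s \<delta> B \<le> hausdorff_delta s \<delta> (A \<union> B)"
proof (rule hausdorff_delta_greatest)
  fix C assume C: "hausdorff_cover \<delta> (A \<union> B) C"
  \<comment> \<open>Members that miss \<open>E\<close> are replaced by the empty set, so that the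
    indexing is kept while their weight becomes zero.\<close>
  define P where "P = (\<lambda>E i. if C i \<inter> E = {} then {} else C i)"
  have cov: "hausdorff_cover \<delta> E (P E)" if "E \<subseteq> A \<union> B" for E
    using that C \<open>0 < \<delta>\<close> by (auto simp: P_def split: if_splits) blast
  have disj: "P A i = {} \<or> P B i = {}" for i
  proof (rule ccontr)
    assume "\<not> ?thesis"
    then obtain x y where "x \<in> C i" "x \<in> A" "y \<in> C i" "y \<in> B"
      by (auto simp: P_def split: if_splits)
    then have "\<delta> < dist x y" "dist x y \<le> diameter (C i)"
      using assms(3) C diameter_bounded_bound by blast+
    then show False
      using C by (meson leD order_trans)
  qed
  have sub: "P E i = {} \<or> P E i = C i" for E i
    by (simp add: P_def)
  have "hausdorff_weight s (P A i) + hausdorff_weight s (P B i) \<le> hausdorff_weight s (C i)" for i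
  proof -
    consider "P A i = {}" "P B i = {}" | "P A i = {}" "P B i = C i" | "P A i = C i" "P B i = {}"
      using disj sub by blast
    then show ?thesis
      using assms(1) by cases (simp_all add: zero_power)
  qed
  then have "(\<Sum>i. hausdorff_weight s (P A i)) + (\<Sum>i. hausdorff_weight s (P B i))
      \<le> (\<Sum>i. hausdorff_weight s (C i))"
    by (subst suminf_add) (auto intro!: suminf_le)
  moreover have "hausdorff_delta s \<delta> A \<le> (\<Sum>i. hausdorff_weight s (P A i))"
    "hausdorff_delta s \<delta> B \<le> (\<Sum>i. hausdorff_weight s (P B i))"
    using cov by (simp_all add: hausdorff_delta_le)
  ultimately show "hausdorff_delta s \<delta> A + hausdorff_delta s \<delta> B \<le> (\<Sum>i. hausdorff_weight s (C i))"
    by (meson add_mono order_trans)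
qed

text \<open>Below the scale \<open>e\<close> the set functions \<open>hausdorff_delta\<close> are
  superadditive on \<open>A\<close> and \<open>B\<close>. The suprema over the two scales are then
  taken one after the other.\<close>

lemma hausdorff_outer_separated:
  assumes "s > 0" "0 < e" "\<And>x y. x \<in> A \<Longrightarrow> y \<in> B \<Longrightarrow> e \<le> dist x y"
  shows "hausdorff_outer s A + hausdorff_outer s B \<le> hausdorff_outer s (A \<union> B)"
proof -
  have le: "hausdorff_delta s \<delta> A + hausdorff_delta s \<delta>' B \<le> hausdorff_outer s (A \<union> B)"
    if "\<delta> > 0" "\<delta>' > 0" for \<delta> \<delta>'
  proof -
    \<comment> \<open>A common scale below both given ones, and strictly below \<open>e\<close>
      because separation at scale \<open>d\<close> requires a strict inequality.\<close>
    define d where "d = min (min \<delta> \<delta>') (e / 2)"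
    have d: "0 < d" "d \<le> \<delta>" "d \<le> \<delta>'" "d < e"
      using that assms(2) by (auto simp: d_def min_def)
    have "hausdorff_delta s \<delta> A + hausdorff_delta s \<delta>' B \<le> hausdorff_delta s d A + hausdorff_delta s d B"
      using d by (intro add_mono hausdorff_delta_antimono)
    also have "\<dots> \<le> hausdorff_delta s d (A \<union> B)"
      using d assms by (intro hausdorff_delta_separated) (auto intro: less_le_trans)
    also have "\<dots> \<le> hausdorff_outer s (A \<union> B)"
      using d by (intro hausdorff_delta_le_outer)
    finally show ?thesis .
  qed
  have "hausdorff_outer s A + hausdorff_delta s \<delta>' B \<le> hausdorff_outer s (A \<union> B)" if "\<delta>' > 0" for \<delta>'
    unfolding hausdorff_outer_def[of s A] using le that
    by (subst ennreal_SUP_add_left[symmetric]) (auto intro!: SUP_least)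
  then show ?thesis
    unfolding hausdorff_outer_def[of s B]
    by (subst ennreal_SUP_add_right) (auto intro!: SUP_least)
qed

subsection \<open>Borel sets are Hausdorff measurable\<close>

lemma hausdorff_outer_Un: "s > 0 \<Longrightarrow> hausdorff_outer s (A \<union> B) \<le> hausdorff_outer s A + hausdorff_outer s B"
proof -
  assume s: "s > 0"
  have "hausdorff_outer s (A \<union> B) \<le> (\<Sum>i::nat. hausdorff_outer s (if i = 0 then A else if i = 1 then B else {}))"
    by (rule order_trans[OF _ hausdorff_outer_countably_subadditive], rule hausdorff_outer_subset)
      (auto split: if_splits)
  also have "\<dots> = (\<Sum>i<2::nat. hausdorff_outer s (if i = 0 then A else if i = 1 then B else {}))"
    using s by (intro suminf_finite) (auto simp: hausdorff_outer_empty)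
  finally show ?thesis
    by (simp add: numeral_2_eq_2)
qed

text \<open>The shells of \<open>A\<close> at distance between \<open>1/(k+2)\<close> and \<open>1/(k+1)\<close> from a closed set are
  positively separated once every other one is dropped, so their measures form a convergent series
  and the part of \<open>A\<close> close to the closed set is negligible in the limit.\<close>

lemma hausdorff_outer_closed_measurable:
  fixes C :: "'a::metric_space set"
  assumes s: "s > 0" and C: "closed C"
  shows "hausdorff_outer s (A \<inter> C) + hausdorff_outer s (A - C) \<le> hausdorff_outer s A"
proof (cases "C = {} \<or> hausdorff_outer s A = top")
  case True
  then show ?thesis
    using s by (auto simp: hausdorff_outer_empty)
next
  case False
  then have fin: "hausdorff_outer s A < top" and ne: "C \<noteq> {}"
    by (auto simp: less_top)
  let ?d = "\<lambda>x. infdist x C"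
  \<comment> \<open>\<open>R k\<close> is a shell around \<open>C\<close>, and \<open>I n\<close> is
    the part of \<open>A\<close> that stays away from \<open>C\<close> by at least
    \<open>1 / (n + 1)\<close>.\<close>
  define R where "R = (\<lambda>k::nat. {x \<in> A. 1 / (k + 2) \<le> ?d x \<and> ?d x < 1 / (k + 1)})"
  define I where "I = (\<lambda>n::nat. {x \<in> A. 1 / (n + 1) \<le> ?d x})"
  define g where "g = (\<lambda>k. hausdorff_outer s (R k))"
  have sep: "\<delta> - \<epsilon> \<le> dist x y" if "\<delta> \<le> ?d x" "?d y \<le> \<epsilon>" for x y \<delta> \<epsilon>
    using infdist_triangle[of x C y] that by linarith
  \<comment> \<open>The offset \<open>r\<close> is used with the values 0 and 1, for the shells of
    even and of odd index.\<close>
  have sum_shells: "(\<Sum>k<N. g (2 * k + r)) \<le> hausdorff_outer s (\<Union>k<N. R (2 * k + r))" for N r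
  proof (induction N)
    case (Suc N)
    have "(\<Sum>k<Suc N. g (2 * k + r))
        \<le> hausdorff_outer s (\<Union>k<N. R (2 * k + r)) + hausdorff_outer s (R (2 * N + r))"
      using add_right_mono[OF Suc.IH, of "g (2 * N + r)"] by (simp only: g_def sum.lessThan_Suc)
    also have "\<dots> \<le> hausdorff_outer s ((\<Union>k<N. R (2 * k + r)) \<union> R (2 * N + r))"
    proof (cases "N = 0")
      case False
      \<comment> \<open>The earlier shells lie at distance at least \<open>1 / (2 * N + r)\<close>
        from \<open>C\<close>, the new one at distance less than \<open>1 / (2 * N + r + 1)\<close>.
        The difference bounds the gap; for \<open>N = 0\<close> there is no earlier shell.\<close>
      then have e: "0 < 1 / (2 * N + r) - 1 / (2 * N + r + 1 :: real)"
        by (intro diff_gt_0_iff_gt[THEN iffD2] divide_strict_left_mono mult_pos_pos) auto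
      show ?thesis
      proof (rule hausdorff_outer_separated[OF s e])
        fix x y assume "x \<in> (\<Union>k<N. R (2 * k + r))" and y: "y \<in> R (2 * N + r)"
        then obtain k where k: "k < N" "x \<in> R (2 * k + r)"
          by blast
        have "1 / (2 * N + r) \<le> 1 / (2 * k + r + 2 :: real)"
          using k(1) by (intro divide_left_mono) (auto simp: add_pos_nonneg)
        then show "1 / (2 * N + r) - 1 / (2 * N + r + 1 :: real) \<le> dist x y"
          using k y by (intro sep) (auto simp: R_def add_ac)
      qed
    qed (simp add: s hausdorff_outer_empty)
    also have "(\<Union>k<N. R (2 * k + r)) \<union> R (2 * N + r) = (\<Union>k<Suc N. R (2 * k + r))"
      by (auto simp: lessThan_Suc)
    finally show ?case .
  qed (simp add: s hausdorff_outer_empty)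
  have half: "(\<Sum>k<N. g (2 * k + r)) \<le> hausdorff_outer s A" for N r
    by (rule order_trans[OF sum_shells], rule hausdorff_outer_subset) (auto simp: R_def)
  have parity: "(\<Sum>k<2 * N. g k) = (\<Sum>k<N. g (2 * k + 0)) + (\<Sum>k<N. g (2 * k + 1))" for N
    by (induction N) (auto simp: algebra_simps)
  have bd: "(\<Sum>k<2 * N. g k) \<le> 2 * hausdorff_outer s A" for N
    unfolding parity mult_2[of "hausdorff_outer s A"] by (intro add_mono half)
  have "(\<Sum>k. g k) \<le> 2 * hausdorff_outer s A"
  proof (rule suminf_le_const)
    fix N
    have "(\<Sum>k<N. g k) \<le> (\<Sum>k<2 * N. g k)"
      by (intro sum_mono2) auto
    then show "(\<Sum>k<N. g k) \<le> 2 * hausdorff_outer s A"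
      using bd order_trans by blast
  qed auto
  then have gfin: "(\<Sum>k. g k) < top"
    using fin by (auto simp: ennreal_mult_less_top intro: le_less_trans)
  \<comment> \<open>The partial sum is added on both sides so that the tail of the series is
    completed to the full series. This avoids subtraction in \<open>ennreal\<close>; the finite
    series is cancelled only after the limit in \<open>n\<close>.\<close>
  have "(\<Sum>k<n. g k) + (hausdorff_outer s (A \<inter> C) + hausdorff_outer s (A - C))
      \<le> hausdorff_outer s A + (\<Sum>k. g k)" for n
  proof -
    have "A - C \<subseteq> I n \<union> (\<Union>k. R (k + n))"
    proof
      fix x assume x: "x \<in> A - C"
      then have pos: "?d x > 0"
        using C ne by (metis DiffD2 infdist_nonneg in_closed_iff_infdist_zero order_le_less)
      obtain j :: nat where "1 / ?d x < j"
        using reals_Archimedean2 by blast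
      then have j: "1 / (real j + 1) \<le> ?d x"
        using pos by (simp add: field_simps)
      \<comment> \<open>The least \<open>m\<close> with this bound locates \<open>x\<close>: in
        \<open>I n\<close> if \<open>m \<le> n\<close>, otherwise in the shell
        \<open>R (m - 1)\<close>.\<close>
      define m where "m = (LEAST m::nat. 1 / (real m + 1) \<le> ?d x)"
      have m: "1 / (real m + 1) \<le> ?d x"
        unfolding m_def using j by (rule LeastI)
      show "x \<in> I n \<union> (\<Union>k. R (k + n))"
      proof (cases "m \<le> n")
        case True
        then have "1 / (real n + 1) \<le> 1 / (real m + 1)"
          by (intro divide_left_mono) auto
        then show ?thesis
          using m x by (auto simp: I_def)
      next
        case False
        then have "\<not> 1 / (real (m - 1) + 1) \<le> ?d x"
          unfolding m_def by (intro not_less_Least) simp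
        moreover have "m = Suc (m - 1)"
          using False by simp
        ultimately have "x \<in> R (m - 1)"
          using m x by (auto simp: R_def add.commute)
        moreover have "m - 1 = (m - 1 - n) + n"
          using False by simp
        ultimately show ?thesis
          by (metis UNIV_I UN_I UnI2)
      qed
    qed
    then have "hausdorff_outer s (A - C) \<le> hausdorff_outer s (I n) + hausdorff_outer s (\<Union>k. R (k + n))"
      by (meson hausdorff_outer_subset hausdorff_outer_Un[OF s] order_trans)
    also have "\<dots> \<le> hausdorff_outer s (I n) + (\<Sum>k. g (k + n))"
      unfolding g_def by (intro add_left_mono hausdorff_outer_countably_subadditive)
    finally have "(\<Sum>k<n. g k) + (hausdorff_outer s (A \<inter> C) + hausdorff_outer s (A - C))
        \<le> (\<Sum>k<n. g k) + (hausdorff_outer s (A \<inter> C) + (hausdorff_outer s (I n) + (\<Sum>k. g (k + n))))"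
      by (intro add_left_mono)
    also have "\<dots> = (hausdorff_outer s (A \<inter> C) + hausdorff_outer s (I n)) + ((\<Sum>k<n. g k) + (\<Sum>k. g (k + n)))"
      by (simp only: ac_simps)
    also have "(\<Sum>k<n. g k) + (\<Sum>k. g (k + n)) = (\<Sum>k. g k)"
      by (subst suminf_offset[of g n]) (auto simp: add.commute)
    also have "hausdorff_outer s (A \<inter> C) + hausdorff_outer s (I n) \<le> hausdorff_outer s (A \<inter> C \<union> I n)"
    proof (rule hausdorff_outer_separated[OF s])
      fix x y assume xy: "x \<in> A \<inter> C" "y \<in> I n"
      then have "1 / (real n + 1) - 0 \<le> dist y x"
        by (intro sep) (auto simp: I_def)
      then show "1 / (real n + 1) \<le> dist x y"
        by (simp add: dist_commute)
    qed simp
    also have "\<dots> \<le> hausdorff_outer s A"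
      by (rule hausdorff_outer_subset) (auto simp: I_def)
    finally show ?thesis
      by (simp add: add_right_mono)
  qed
  then have "(\<Sum>k. g k) + (hausdorff_outer s (A \<inter> C) + hausdorff_outer s (A - C))
      \<le> hausdorff_outer s A + (\<Sum>k. g k)"
    by (rule ennreal_suminf_bound_add)
  then show ?thesis
    using gfin by (auto simp: add.commute[of "hausdorff_outer s A"] ennreal_add_left_cancel_le)
qed

text \<open>By Caratheodory, an outer measure is a measure on the sets that split every set
  additively. These form a sigma-algebra that contains the closed sets, hence all Borel
  sets.\<close>

lemma hausdorff_outer_measure_space:
  assumes "s > 0"
  shows "measure_space UNIV (sets borel) (hausdorff_outer s :: 'a::metric_space set \<Rightarrow> ennreal)"
proof -
  let ?H = "hausdorff_outer s :: 'a set \<Rightarrow> ennreal"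
  let ?L = "lambda_system UNIV UNIV ?H"
  interpret U: sigma_algebra UNIV "UNIV :: 'a set set"
    using sigma_algebra_Pow[of UNIV] by simp
  have "outer_measure_space UNIV ?H"
    using assms by (auto simp: outer_measure_space_def positive_def increasing_def
        countably_subadditive_def hausdorff_outer_empty hausdorff_outer_subset
        hausdorff_outer_countably_subadditive)
  then have L: "measure_space UNIV ?L ?H"
    by (rule U.caratheodory_lemma)
  have "closed C \<Longrightarrow> C \<in> ?L" for C
    unfolding U.lambda_system_eq
  proof safe
    fix x assume "closed C"
    have "?H x \<le> ?H (x \<inter> C) + ?H (x - C)"
      using hausdorff_outer_Un[OF assms, of "x \<inter> C" "x - C"] by (simp add: Int_Diff_Un)
    then show "?H (x \<inter> C) + ?H (x - C) = ?H x"
      using hausdorff_outer_closed_measurable[OF assms \<open>closed C\<close>] by (meson antisym)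
  qed auto
  then have "sigma_sets UNIV (Collect closed) \<subseteq> ?L"
    using L by (intro sigma_algebra.sigma_sets_subset) (auto simp: measure_space_def)
  then have "sets borel \<subseteq> ?L"
    by (simp add: borel_eq_closed)
  then show ?thesis
    using L sets.sigma_algebra_axioms[of "borel :: 'a measure"]
    by (auto simp: measure_space_def positive_def countably_additive_def subset_iff)
qed

lemma sets_hausdorff_measure [simp, measurable_cong]: "sets (hausdorff_measure s) = sets borel"
  using sets.sigma_sets_eq[of borel] by (simp add: hausdorff_measure_def)

lemma space_hausdorff_measure [simp]: "space (hausdorff_measure s) = UNIV"
  by (simp add: hausdorff_measure_def)

text \<open>\<open>measure_of\<close> returns the given set function only if that function is a
  measure, which is what the Caratheodory argument provides.\<close>

lemma emeasure_hausdorff_measure: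
  assumes "s > 0" "A \<in> sets borel"
  shows "emeasure (hausdorff_measure s) A = hausdorff_outer s A"
  unfolding hausdorff_measure_def using hausdorff_outer_measure_space[OF assms(1)] assms(2)
  by (intro emeasure_measure_of_sigma) (auto simp: measure_space_def)

subsection \<open>Hausdorff measure of top dimension\<close>

text \<open>By Tonelli and translation invariance, integrating \<open>1\<^sub>A(x) 1\<^sub>Q(x + y)\<close> over \<open>x\<close> and \<open>y\<close> in both
  orders, with \<open>Q\<close> the unit cube, gives \<open>N(A) \<lambda>(Q) = N(Q) \<lambda>(-A)\<close>.\<close>

lemma emeasure_translation_invariant:
  fixes N :: "'a::euclidean_space measure"
  assumes sets_N [measurable_cong]: "sets N = sets borel" and "sigma_finite_measure N"
    and inv: "\<And>a. distr N borel ((+) a) = N" and A [measurable]: "A \<in> sets borel"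
  shows "emeasure N A = emeasure N (cbox 0 One) * emeasure lborel A"
proof -
  interpret N: sigma_finite_measure N by fact
  interpret P: pair_sigma_finite N lborel
    by (simp add: N.sigma_finite_measure_axioms pair_sigma_finite.intro sigma_finite_lborel)
  let ?Q = "cbox 0 One :: 'a set"
  have shift: "(\<integral>\<^sup>+x. f (a + x) \<partial>M) = (\<integral>\<^sup>+x. f x \<partial>M)"
    if [measurable]: "f \<in> borel_measurable borel" and "sets M = sets borel"
      "distr M borel ((+) a) = M" for f :: "'a \<Rightarrow> ennreal" and M a
  proof -
    have [measurable]: "(+) a \<in> measurable M borel"
      using that(2) by (simp cong: measurable_cong_sets)
    show ?thesis
      by (subst (2) that(3)[symmetric]) (simp add: nn_integral_distr)
  qed
  have Q: "(\<integral>\<^sup>+y. indicator ?Q (x + y) \<partial>lborel) = (1::ennreal)" for x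
    by (subst shift[of "indicator ?Q"]) (simp_all add: lborel_distr_plus)
  \<comment> \<open>Lebesgue measure is invariant under the reflection
    \<open>y \<mapsto> x - y\<close>, which replaces the volume of \<open>-A\<close> by that of
    \<open>A\<close>.\<close>
  have neg: "(\<integral>\<^sup>+y. indicator A (x - y) \<partial>lborel) = emeasure lborel A" for x
  proof -
    have "distr lborel borel (\<lambda>y. x - y) = lborel"
      using lborel_affine[of "-1" x] by (simp add: density_1 one_ennreal_def[symmetric])
    then have "emeasure lborel A = emeasure (distr lborel borel (\<lambda>y. x - y)) A"
      by simp
    also have "\<dots> = (\<integral>\<^sup>+y. indicator A y \<partial>distr lborel borel (\<lambda>y. x - y))"
      by simp
    also have "\<dots> = (\<integral>\<^sup>+y. indicator A (x - y) \<partial>lborel)"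
      by (subst nn_integral_distr) auto
    finally show ?thesis
      by simp
  qed
  have "emeasure N A = (\<integral>\<^sup>+x. indicator A x * (\<integral>\<^sup>+y. indicator ?Q (x + y) \<partial>lborel) \<partial>N)"
    by (simp add: Q sets_N)
  also have "\<dots> = (\<integral>\<^sup>+x. \<integral>\<^sup>+y. indicator A x * indicator ?Q (x + y) \<partial>lborel \<partial>N)"
    by (simp add: nn_integral_cmult)
  also have "\<dots> = (\<integral>\<^sup>+y. \<integral>\<^sup>+x. indicator A x * indicator ?Q (x + y) \<partial>N \<partial>lborel)"
    by (rule P.Fubini'[symmetric]) measurable
  \<comment> \<open>For fixed \<open>y\<close> the inner integral is shifted by \<open>-y\<close>,
    which is where the invariance of \<open>N\<close> enters.\<close>
  also have "\<dots> = (\<integral>\<^sup>+y. \<integral>\<^sup>+x. indicator A (x - y) * indicator ?Q x \<partial>N \<partial>lborel)"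
  proof (rule nn_integral_cong)
    fix y
    show "(\<integral>\<^sup>+x. indicator A x * indicator ?Q (x + y) \<partial>N)
        = (\<integral>\<^sup>+x. indicator A (x - y) * indicator ?Q x \<partial>N)"
      using shift[of "\<lambda>x. indicator A x * indicator ?Q (x + y)" N "-y"] sets_N inv by simp
  qed
  also have "\<dots> = (\<integral>\<^sup>+x. \<integral>\<^sup>+y. indicator A (x - y) * indicator ?Q x \<partial>lborel \<partial>N)"
    by (rule P.Fubini') measurable
  also have "\<dots> = (\<integral>\<^sup>+x. emeasure lborel A * indicator ?Q x \<partial>N)"
    by (simp add: nn_integral_multc neg)
  also have "\<dots> = emeasure N ?Q * emeasure lborel A"
    by (simp add: nn_integral_cmult sets_N mult.commute)
  finally show ?thesis .
qed

section \<open>Finiteness on bounded sets and comparison with Lebesgue measure\<close>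

lemma hausdorff_delta_finite_cover:
  assumes "s > 0" "\<delta> \<ge> 0" "finite I" "A \<subseteq> (\<Union>i\<in>I. C i)"
    and C: "\<And>i. i \<in> I \<Longrightarrow> bounded (C i) \<and> diameter (C i) \<le> \<delta>"
  shows "hausdorff_delta s \<delta> A \<le> (\<Sum>i\<in>I. hausdorff_weight s (C i))"
proof -
  obtain h where h: "bij_betw h {0..<card I} I"
    using ex_bij_betw_nat_finite[OF \<open>finite I\<close>] by blast
  define D where "D = (\<lambda>n. if n < card I then C (h n) else {})"
  have hI: "h n \<in> I" if "n < card I" for n
    using h that by (auto simp: bij_betw_def)
  have "A \<subseteq> (\<Union>n. D n)"
  proof
    fix x assume "x \<in> A"
    then obtain i where "i \<in> I" "x \<in> C i"
      using assms(4) by blast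
    moreover obtain n where "n < card I" "h n = i"
      using h \<open>i \<in> I\<close> by (metis atLeastLessThan_iff bij_betw_def imageE)
    ultimately have "x \<in> D n"
      by (simp add: D_def)
    then show "x \<in> (\<Union>n. D n)"
      by blast
  qed
  then have "hausdorff_delta s \<delta> A \<le> (\<Sum>n. hausdorff_weight s (D n))"
    using assms(2) C hI by (intro hausdorff_delta_le) (auto simp: D_def)
  also have "\<dots> = (\<Sum>n\<in>{0..<card I}. hausdorff_weight s (D n))"
    using assms(1) by (intro suminf_finite) (auto simp: D_def zero_power)
  also have "\<dots> = (\<Sum>n\<in>{0..<card I}. hausdorff_weight s (C (h n)))"
    by (intro sum.cong) (auto simp: D_def)
  also have "\<dots> = (\<Sum>i\<in>I. hausdorff_weight s (C i))"
    by (rule sum.reindex_bij_betw[OF h])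
  finally show ?thesis .
qed

text \<open>A grid of mesh size \<open>r / N\<close> covers the cube by \<open>(N + 1) ^ s\<close>
  boxes of diameter at most \<open>s * r / N\<close>, where \<open>s = CARD('k)\<close>. The total
  weight is bounded independently of \<open>N\<close>.\<close>

lemma hausdorff_outer_cube_finite:
  assumes "r > 0"
  shows "hausdorff_outer CARD('k) (cbox 0 (\<chi> i. r) :: (real^'k) set) < top"
proof -
  let ?s = "CARD('k)"
  \<comment> \<open>The value left after \<open>(2 * N) ^ s\<close>, an upper bound for the number
    of boxes, cancels against the denominators of the diameters.\<close>
  define c where "c = unit_ball_vol (real ?s) * (?s * r) ^ ?s"
  have le: "hausdorff_delta ?s (?s * r / N) (cbox 0 (\<chi> i. r) :: (real^'k) set) \<le> ennreal c"
    if "N > 0" for N :: nat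
  proof -
    \<comment> \<open>The indices run up to \<open>N\<close> inclusive: a coordinate equal to
      \<open>r\<close> has \<open>N\<close> as its rounded-down index.\<close>
    define V where "V = (UNIV :: 'k set) \<rightarrow>\<^sub>E {..N}"
    define C where "C = (\<lambda>v::'k \<Rightarrow> nat. cbox (\<chi> i. real (v i) * (r / N)) (\<chi> i. (real (v i) + 1) * (r / N)))"
    have cover: "cbox 0 (\<chi> i. r) \<subseteq> (\<Union>v\<in>V. C v)"
    proof
      fix x :: "real^'k" assume x: "x \<in> cbox 0 (\<chi> i. r)"
      define v where "v = (\<lambda>i. nat \<lfloor>x $ i / (r / N)\<rfloor>)"
      have v: "v i \<le> N \<and> real (v i) * (r / N) \<le> x $ i \<and> x $ i \<le> (real (v i) + 1) * (r / N)" for i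
      proof -
        have xi: "0 \<le> x $ i" "x $ i \<le> r"
          using x by (auto simp: mem_box_cart)
        have rN: "r / N > 0"
          using \<open>r > 0\<close> \<open>N > 0\<close> by simp
        have "0 \<le> x $ i / (r / N)"
          using xi rN by simp
        then have "real (v i) = of_int \<lfloor>x $ i / (r / N)\<rfloor>"
          by (simp add: v_def)
        then have v1: "v i \<le> x $ i / (r / N)" "x $ i / (r / N) \<le> real (v i) + 1"
          by linarith+
        have "x $ i / (r / N) \<le> N"
          using xi \<open>r > 0\<close> \<open>N > 0\<close> by (simp add: field_simps)
        then have "v i \<le> N"
          using v1(1) by linarith
        then show ?thesis
          using v1 unfolding pos_le_divide_eq[OF rN] pos_divide_le_eq[OF rN] by blast
      qed
      then have "x \<in> C v"
        unfolding C_def mem_box_cart vec_lambda_beta by blast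
      moreover have "v \<in> V"
        using v by (auto simp: V_def PiE_UNIV_domain)
      ultimately show "x \<in> (\<Union>v\<in>V. C v)"
        by blast
    qed
    have diam: "diameter (C v) \<le> ?s * r / N" for v
    proof (rule diameter_le)
      show "C v \<noteq> {} \<or> 0 \<le> ?s * r / N"
        using \<open>r > 0\<close> by simp
      fix x y assume xy: "x \<in> C v" "y \<in> C v"
      have "norm (x - y) \<le> (\<Sum>i\<in>UNIV. \<bar>(x - y) $ i\<bar>)"
        by (rule norm_le_l1_cart)
      also have "\<dots> \<le> (\<Sum>i\<in>(UNIV::'k set). r / N)"
      proof (rule sum_mono)
        fix i
        have "(real (v i) + 1) * (r / N) = real (v i) * (r / N) + r / N"
          by (simp only: distrib_right mult_1_left)
        moreover have "real (v i) * (r / N) \<le> x $ i \<and> x $ i \<le> (real (v i) + 1) * (r / N)"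
          "real (v i) * (r / N) \<le> y $ i \<and> y $ i \<le> (real (v i) + 1) * (r / N)"
          using xy unfolding C_def mem_box_cart vec_lambda_beta by blast+
        ultimately show "\<bar>(x - y) $ i\<bar> \<le> r / N"
          unfolding vector_minus_component by linarith
      qed
      also have "\<dots> = ?s * r / N"
        by simp
      finally show "norm (x - y) \<le> ?s * r / N" .
    qed
    have bC: "bounded (C v)" for v
      by (simp add: C_def bounded_cbox)
    have "finite V"
      by (simp add: V_def finite_PiE)
    then have "hausdorff_delta ?s (?s * r / N) (cbox 0 (\<chi> i. r) :: (real^'k) set)
        \<le> (\<Sum>v\<in>V. hausdorff_weight ?s (C v))"
      using \<open>r > 0\<close> cover diam bC by (intro hausdorff_delta_finite_cover) auto
    also have "\<dots> \<le> (\<Sum>v\<in>V. ennreal (unit_ball_vol (real ?s) * (?s * r / N / 2) ^ ?s))"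
      using diam bC by (intro sum_mono hausdorff_weight_mono)
    also have "\<dots> = ennreal (card V * (unit_ball_vol (real ?s) * (?s * r / N / 2) ^ ?s))"
      by (subst sum_ennreal) (use \<open>r > 0\<close> in simp_all)
    also have "\<dots> \<le> ennreal ((2 * real N) ^ ?s * (unit_ball_vol (real ?s) * (?s * r / N / 2) ^ ?s))"
    proof (intro ennreal_leI mult_right_mono)
      have "real (card V) = (real N + 1) ^ ?s"
        by (simp add: V_def card_PiE add.commute)
      also have "\<dots> \<le> (2 * real N) ^ ?s"
        using \<open>N > 0\<close> by (intro power_mono) auto
      finally show "real (card V) \<le> (2 * real N) ^ ?s" .
      show "0 \<le> unit_ball_vol (real ?s) * (?s * r / N / 2) ^ ?s"
        using \<open>r > 0\<close> by simp
    qed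
    also have "(2 * real N) ^ ?s * (unit_ball_vol (real ?s) * (?s * r / N / 2) ^ ?s) = c"
      using \<open>N > 0\<close> by (simp add: c_def power_mult_distrib power_divide)
    finally show ?thesis .
  qed
  have "hausdorff_outer ?s (cbox 0 (\<chi> i. r) :: (real^'k) set) \<le> ennreal c"
  proof (rule hausdorff_outer_least)
    fix \<delta> :: real assume "\<delta> > 0"
    obtain N :: nat where N: "?s * r / \<delta> < N"
      using reals_Archimedean2 by blast
    have "0 < ?s * r / \<delta>"
      using \<open>r > 0\<close> \<open>\<delta> > 0\<close> by simp
    then have "N > 0"
      using N by (metis less_trans of_nat_0_less_iff)
    then have "?s * r / N \<le> \<delta>"
      using N \<open>\<delta> > 0\<close> by (simp add: field_simps)
    then show "hausdorff_delta ?s \<delta> (cbox 0 (\<chi> i. r) :: (real^'k) set) \<le> ennreal c"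
      using le[OF \<open>N > 0\<close>] hausdorff_delta_antimono order_trans by blast
  qed
  then show ?thesis
    using le_less_trans ennreal_less_top by blast
qed

lemma hausdorff_outer_translation: "hausdorff_outer s ((+) a ` A) = hausdorff_outer s A"
  for a :: "'a::real_normed_vector"
  by (rule hausdorff_outer_isometric_image) simp

lemma hausdorff_outer_bounded_finite:
  fixes A :: "(real^'k) set"
  assumes "bounded A"
  shows "hausdorff_outer CARD('k) A < top"
proof -
  obtain r where r: "r > 0" "\<And>x. x \<in> A \<Longrightarrow> norm x \<le> r"
    using assms bounded_pos by blast
  have "(+) (\<chi> i. r) ` A \<subseteq> cbox 0 (\<chi> i. 2 * r)"
  proof clarify
    fix x assume "x \<in> A"
    then have "\<bar>x $ i\<bar> \<le> r" for i
      using r(2) component_le_norm_cart order_trans by blast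
    then have "0 \<le> r + x $ i \<and> r + x $ i \<le> 2 * r" for i
      by (smt (verit))
    then show "(\<chi> i. r) + x \<in> cbox 0 (\<chi> i. 2 * r)"
      by (simp add: mem_box_cart)
  qed
  then have "hausdorff_outer CARD('k) ((+) (\<chi> i. r) ` A) < top"
    using r(1) by (intro le_less_trans[OF hausdorff_outer_subset hausdorff_outer_cube_finite[of "2 * r"]]) auto
  then show ?thesis
    by (simp add: hausdorff_outer_translation)
qed

text \<open>The Hausdorff measure of top dimension is translation invariant and finite on balls,
  hence proportional to Lebesgue measure. The unit cube fixes the factor, which is left
  unevaluated.\<close>

lemma hausdorff_outer_eq_lborel:
  fixes A :: "(real^'k) set"
  assumes A: "A \<in> sets borel"
  shows "hausdorff_outer CARD('k) A =
    hausdorff_outer CARD('k) (cbox 0 One :: (real^'k) set) * emeasure lborel A"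
proof -
  let ?N = "hausdorff_measure CARD('k) :: (real^'k) measure"
  have em: "emeasure ?N B = hausdorff_outer CARD('k) B" if "B \<in> sets borel" for B
    using that by (simp add: emeasure_hausdorff_measure)
  have "sigma_finite_measure ?N"
  proof
    have "(\<Union>n::nat. cball 0 (real n)) = (UNIV :: (real^'k) set)"
      by (auto intro: real_arch_simple)
    then show "\<exists>\<B>. countable \<B> \<and> \<B> \<subseteq> sets ?N \<and> \<Union>\<B> = space ?N \<and> (\<forall>B\<in>\<B>. emeasure ?N B \<noteq> \<infinity>)"
      by (intro exI[of _ "range (\<lambda>n::nat. cball 0 (real n))"])
        (use hausdorff_outer_bounded_finite[OF bounded_cball] in \<open>auto simp: em less_top\<close>)
  qed
  moreover have "distr ?N borel ((+) a) = ?N" for a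
  proof (rule measure_eqI)
    fix B assume "B \<in> sets (distr ?N borel ((+) a))"
    then have B: "B \<in> sets borel"
      by simp
    have eq: "(+) a -` B = (+) (- a) ` B"
    proof (intro set_eqI iffI)
      fix x assume "x \<in> (+) a -` B"
      then have "- a + (a + x) \<in> (+) (- a) ` B"
        by (intro imageI) simp
      then show "x \<in> (+) (- a) ` B"
        by simp
    qed auto
    have "(+) a -` B \<in> sets borel"
      using measurable_sets[of "(+) a" borel borel B] B by simp
    then have "emeasure ?N ((+) a -` B) = hausdorff_outer CARD('k) ((+) a -` B)"
      by (rule em)
    also have "\<dots> = emeasure ?N B"
      unfolding eq em[OF B] by (rule hausdorff_outer_translation)
    finally show "emeasure (distr ?N borel ((+) a)) B = emeasure ?N B"
      using B by (subst emeasure_distr) (simp_all cong: measurable_cong_sets)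
  qed simp
  ultimately have "emeasure ?N A = emeasure ?N (cbox 0 One) * emeasure lborel A"
    using A by (intro emeasure_translation_invariant) auto
  then show ?thesis
    using A by (simp add: em)
qed

subsection \<open>Flat simplices and their affine images\<close>

text \<open>Polarisation: the inner product is determined by the norms of \<open>x\<close>,
  \<open>y\<close> and their sum.\<close>

lemma norm_preserving_inner:
  fixes f :: "'a::real_inner \<Rightarrow> 'b::real_inner"
  assumes "linear f" "\<And>x. norm (f x) = norm x"
  shows "f x \<bullet> f y = x \<bullet> y"
  using assms by (simp add: dot_norm linear_add[symmetric])

lemma linear_axis_expansion:
  fixes f :: "real^'k \<Rightarrow> 'b::real_vector"
  assumes "linear f"
  shows "f x = (\<Sum>j\<in>UNIV. x $ j *\<^sub>R f (axis j 1))"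
proof -
  have "f x = f (\<Sum>j\<in>UNIV. x $ j *\<^sub>R axis j 1)"
    using basis_expansion[of x] by (simp add: scalar_mult_eq_scaleR)
  then show ?thesis
    using assms by (simp add: linear_sum linear_cmul)
qed

text \<open>Differences of points are differences of vectors based at \<open>a\<close>. This form
  links the tangent space to affine hulls and affine dimension.\<close>

lemma tangent_space_eq_span:
  assumes "a \<in> K"
  shows "tangent_space K = span ((\<lambda>x. - a + x) ` K)"
proof (rule antisym)
  show "tangent_space K \<subseteq> span ((\<lambda>x. - a + x) ` K)"
    unfolding tangent_space_def
  proof (rule span_minimal)
    show "{x - y |x y. x \<in> K \<and> y \<in> K} \<subseteq> span ((\<lambda>x. - a + x) ` K)"
    proof clarify
      fix x y assume "x \<in> K" "y \<in> K"
      then have "(- a + x) - (- a + y) \<in> span ((\<lambda>x. - a + x) ` K)"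
        by (intro span_diff span_base) auto
      then show "x - y \<in> span ((\<lambda>x. - a + x) ` K)"
        by simp
    qed
  qed simp
  show "span ((\<lambda>x. - a + x) ` K) \<subseteq> tangent_space K"
    unfolding tangent_space_def using assms by (intro span_mono) force
qed

text \<open>The tangent space has dimension \<open>CARD('k)\<close>, so it is isometric to the whole
  of \<open>real^'k\<close>. Pulling \<open>K\<close> back along this isometry moves questions of
  measure and relative interior to a convex body \<open>B\<close> in top dimension.\<close>

lemma simplex_chart:
  fixes K :: "(real^'n) set"
  assumes card: "CARD('n) = CARD('k) + 1" and K: "(int CARD('n) - 1) simplex K"
  obtains \<iota> :: "real^'k \<Rightarrow> real^'n" and p B where "linear \<iota>" "\<And>x. norm (\<iota> x) = norm x"
    "range \<iota> = tangent_space K" "compact B" "convex B" "K = (\<lambda>x. p + \<iota> x) ` B"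
proof -
  have dimK: "aff_dim K = int CARD('k)"
    using aff_dim_simplex[OF K] card by simp
  then obtain p where p: "p \<in> K"
    by (metis aff_dim_empty all_not_in_conv of_nat_0_le_iff neg_0_le_iff_le not_one_le_zero)
  let ?t = "\<lambda>x. - p + x"
  have T: "tangent_space K = span (?t ` K)"
    by (rule tangent_space_eq_span[OF p])
  have "dim (UNIV :: (real^'k) set) = dim (tangent_space K)"
    using aff_dim_eq_dim[of p K] p dimK by (simp add: T hull_inc)
  then obtain \<iota> :: "real^'k \<Rightarrow> real^'n" and g where \<iota>: "linear \<iota>" "linear g"
      "\<iota> ` UNIV = tangent_space K" "\<And>x. x \<in> UNIV \<Longrightarrow> norm (\<iota> x) = norm x"
      "\<And>x. x \<in> tangent_space K \<Longrightarrow> \<iota> (g x) = x"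
    by (rule isometries_subspaces[rotated 2]) (auto simp: tangent_space_def)
  have "\<iota> (g (- p + x)) = - p + x" if "x \<in> K" for x
    using that by (intro \<iota>(5)) (simp add: T span_base)
  then have "K = (\<lambda>x. p + \<iota> x) ` g ` ?t ` K"
    by (force simp: image_image)
  moreover have "compact (g ` ?t ` K)"
    using compact_simplex[OF K] \<iota>(2)
    by (intro compact_continuous_image compact_translation) (simp_all add: linear_continuous_on linear_conv_bounded_linear)
  moreover have "convex (g ` ?t ` K)"
    using convex_simplex[OF K] \<iota>(2) by (intro convex_linear_image convex_translation)
  ultimately show ?thesis
    using \<iota>(1,3,4) by (intro that[of \<iota> "g ` ?t ` K" p]) auto
qed

lemma rel_interior_chart:
  fixes \<iota> :: "'a::euclidean_space \<Rightarrow> 'b::euclidean_space"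
  assumes "linear \<iota>" "\<And>x. norm (\<iota> x) = norm x"
  shows "rel_interior ((\<lambda>x. p + \<iota> x) ` B) = (\<lambda>x. p + \<iota> x) ` rel_interior B"
proof -
  have "inj \<iota>"
    using assms by (metis linear_injective_0 norm_eq_zero)
  then show ?thesis
    using rel_interior_translation[of p "\<iota> ` B"] rel_interior_injective_linear_image[of \<iota> B] assms(1)
    by (simp add: image_image linear_conv_bounded_linear)
qed

lemma borel_rel_interior: "rel_interior K \<in> sets borel" if "closed K" for K :: "'a::euclidean_space set"
proof -
  have "rel_interior K = K - rel_frontier K"
    using that rel_interior_subset[of K] by (auto simp: rel_frontier_def)
  then show ?thesis
    using that closed_rel_frontier[of K] by auto
qed

text \<open>If \<open>B\<close> has empty interior, it is negligible as a convex set. Otherwise the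
  relative interior is the interior, and the frontier of a convex set is negligible.\<close>

lemma emeasure_rel_interior_convex:
  fixes B :: "'a::euclidean_space set"
  assumes "compact B" "convex B"
  shows "emeasure lborel (rel_interior B) = emeasure lborel B"
proof -
  have neg: "negligible (B - rel_interior B)"
  proof (cases "interior B = {}")
    case True
    then show ?thesis
      using assms by (meson negligible_convex_interior negligible_subset Diff_subset)
  next
    case False
    then have "B - rel_interior B \<subseteq> frontier B"
      using closure_subset by (auto simp: rel_interior_nonempty_interior frontier_def)
    then show ?thesis
      using assms negligible_convex_frontier negligible_subset by blast
  qed
  have [measurable]: "B \<in> sets borel" "rel_interior B \<in> sets borel"
    using assms by (auto intro: borel_rel_interior borel_compact compact_imp_closed)
  have "emeasure lborel (B - rel_interior B) = 0"
    using neg by (simp add: negligible_iff_emeasure0)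
  then have "emeasure lborel (rel_interior B \<union> (B - rel_interior B)) = emeasure lborel (rel_interior B)"
    by (intro emeasure_Un_null_set) (auto simp: null_sets_def)
  then show ?thesis
    using rel_interior_subset[of B] by (simp add: Un_absorb1)
qed

lemma hausdorff_outer_chart:
  fixes \<iota> :: "real^'k \<Rightarrow> real^'n"
  assumes "linear \<iota>" "\<And>x. norm (\<iota> x) = norm x"
  shows "hausdorff_outer s ((\<lambda>x. p + \<iota> x) ` A) = hausdorff_outer s A"
  by (rule hausdorff_outer_isometric_image) (simp add: dist_norm linear_diff[symmetric] assms)

lemma area_eq_outer:
  fixes A :: "(real^'n) set"
  assumes "CARD('n) = CARD('k::finite) + 1" "A \<in> sets borel"
  shows "area A = enn2real (hausdorff_outer CARD('k) A)"
  using assms by (simp add: area_def measure_def emeasure_hausdorff_measure)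

text \<open>The range of \<open>h\<close> lies in a hyperplane. Identifying that hyperplane
  isometrically with \<open>real^'k\<close> turns \<open>h\<close> into a square map
  \<open>M\<close>, to which the determinant formula for Lebesgue measure applies.\<close>

lemma hausdorff_outer_linear_image:
  fixes h :: "real^'k::{finite,wellorder} \<Rightarrow> real^'n"
  assumes card: "CARD('n) = CARD('k) + 1" and h: "linear h"
  obtains M :: "real^'k::_ \<Rightarrow> real^'k::_" where "linear M" "\<And>x. norm (M x) = norm (h x)"
    "\<And>B p. compact B \<Longrightarrow> hausdorff_outer CARD('k) ((\<lambda>x. p + h x) ` B) =
       hausdorff_outer CARD('k) (cbox 0 One :: (real^'k::_) set) *
       ennreal (\<bar>det (matrix M)\<bar> * measure lebesgue B)"
proof -
  have "dim (range h) \<le> CARD('k)"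
    using dim_image_le[OF h, of UNIV] by simp
  then have "dim (range h) < DIM(real^'n)"
    using card by simp
  \<comment> \<open>Choosing a hyperplane around the range, rather than the range itself, also
    covers degenerate \<open>h\<close>, whose image has lower dimension.\<close>
  then obtain n where n: "n \<noteq> 0" "\<And>y. y \<in> span (range h) \<Longrightarrow> orthogonal n y"
    using orthogonal_to_subspace_exists by blast
  define W where "W = {y. n \<bullet> y = 0}"
  have hW: "h x \<in> W" for x
    using n(2)[of "h x"] by (simp add: W_def orthogonal_def span_base)
  have "dim (UNIV :: (real^'k::_) set) = dim W"
    using n(1) card by (simp add: W_def dim_hyperplane)
  then obtain \<iota> :: "real^'k::_ \<Rightarrow> real^'n" and g where \<iota>: "linear \<iota>" "linear g"
      "\<And>x. x \<in> UNIV \<Longrightarrow> norm (\<iota> x) = norm x" "\<And>x. x \<in> W \<Longrightarrow> norm (g x) = norm x"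
      "\<And>x. x \<in> W \<Longrightarrow> \<iota> (g x) = x"
    by (rule isometries_subspaces[rotated 2]) (auto simp: W_def subspace_hyperplane)
  define M where "M = g \<circ> h"
  have linM: "linear M"
    unfolding M_def by (rule linear_compose[OF h \<iota>(2)])
  show ?thesis
  proof
    show "linear M" by fact
    show "norm (M x) = norm (h x)" for x
      by (simp add: M_def \<iota>(4) hW)
    fix B :: "(real^'k::_) set" and p assume B: "compact B"
    then have MB: "compact (M ` B)"
      using linM by (simp add: compact_continuous_image linear_continuous_on linear_conv_bounded_linear)
    have "(\<lambda>x. p + h x) ` B = (\<lambda>x. p + \<iota> x) ` M ` B"
      by (simp add: image_image M_def \<iota>(5) hW)
    then have "hausdorff_outer CARD('k) ((\<lambda>x. p + h x) ` B) = hausdorff_outer CARD('k) (M ` B)"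
      using hausdorff_outer_chart[OF \<iota>(1) \<iota>(3)] by simp
    also have "\<dots> = hausdorff_outer CARD('k) (cbox 0 One :: (real^'k::_) set) * emeasure lborel (M ` B)"
      using MB by (intro hausdorff_outer_eq_lborel) (auto intro: borel_compact)
    also have "emeasure lborel (M ` B) = ennreal (measure lebesgue (M ` B))"
      using emeasure_compact_finite[OF MB] borel_compact[OF MB] by (simp add: emeasure_eq_ennreal_measure)
    also have "measure lebesgue (M ` B) = \<bar>det (matrix M)\<bar> * measure lebesgue B"
      using linM B by (intro measure_linear_image lmeasurable_compact)
    finally show "hausdorff_outer CARD('k) ((\<lambda>x. p + h x) ` B) =
       hausdorff_outer CARD('k) (cbox 0 One :: (real^'k::_) set) *
       ennreal (\<bar>det (matrix M)\<bar> * measure lebesgue B)" .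
  qed
qed

section \<open>Determinant inequalities in tangent dimension one and two\<close>

text \<open>For a single entry \<open>a\<close> this is the expansion of the square of
  \<open>\<bar>a\<bar> - 1\<close>.\<close>

lemma det_le_energy_1:
  fixes M :: "real^1 \<Rightarrow> real^1"
  shows "2 * (\<bar>det (matrix M)\<bar> - 1) \<le> (\<Sum>j\<in>UNIV. (norm (M (axis j 1)))\<^sup>2) - CARD(1)"
proof -
  have "2 * \<bar>a\<bar> - 1 \<le> a\<^sup>2" for a :: real
    using zero_le_power2[of "\<bar>a\<bar> - 1"] by (simp add: power2_diff)
  from this[of "M (axis 1 1) $ 1"] show ?thesis
    by (simp add: det_1 matrix_def norm_vector_1 sum_1)
qed

text \<open>The additive constants cancel, and twice the modulus of \<open>a * d - b * c\<close> is
  at most the sum of the squared entries: expand the squares of \<open>a - d\<close> and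
  \<open>b + c\<close> for one sign, of \<open>a + d\<close> and \<open>b - c\<close> for the
  other.\<close>

lemma det_le_energy_2:
  fixes M :: "real^2 \<Rightarrow> real^2"
  shows "2 * (\<bar>det (matrix M)\<bar> - 1) \<le> (\<Sum>j\<in>UNIV. (norm (M (axis j 1)))\<^sup>2) - CARD(2)"
proof -
  have "2 * \<bar>a * d - b * c\<bar> \<le> a\<^sup>2 + c\<^sup>2 + (b\<^sup>2 + d\<^sup>2)" for a b c d :: real
    using zero_le_power2[of "a - d"] zero_le_power2[of "b + c"]
      zero_le_power2[of "a + d"] zero_le_power2[of "b - c"]
    by (simp add: power2_diff power2_sum abs_if)
  from this[where a = "M (axis 1 1) $ 1" and b = "M (axis 2 1) $ 1" and c = "M (axis 1 1) $ 2"
      and d = "M (axis 2 1) $ 2"] show ?thesis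
    by (simp add: det_2 matrix_def sum_2 norm_vec_def L2_set_def)
qed

section \<open>Tangential gradients of affine functions\<close>

text \<open>The value is the orthogonal projection of \<open>a\<close> onto the tangent space,
  expanded in the orthonormal basis \<open>\<iota> (axis j 1)\<close>. Uniqueness holds because at a
  relative interior point one can move both ways in every tangent direction.\<close>

lemma tangential_grad_affine:
  fixes K :: "(real^'n) set" and \<iota> :: "real^'k \<Rightarrow> real^'n"
  assumes x: "x \<in> rel_interior K"
    and \<iota>: "linear \<iota>" "\<And>v. norm (\<iota> v) = norm v" "range \<iota> = tangent_space K"
    and f: "\<And>y. y \<in> K \<Longrightarrow> f y = a \<bullet> y + b"
  shows "tangential_grad K f x = \<iota> (\<chi> j. a \<bullet> \<iota> (axis j 1))"
proof -
  define g where "g = \<iota> (\<chi> j. a \<bullet> \<iota> (axis j 1))"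
  have xK: "x \<in> K"
    using x rel_interior_subset by blast
  have gT: "g \<in> tangent_space K"
    unfolding g_def \<iota>(3)[symmetric] by (rule rangeI)
  have inner_g: "g \<bullet> v = a \<bullet> v" if v: "v \<in> tangent_space K" for v
  proof -
    obtain u where u: "v = \<iota> u"
      using v[unfolded \<iota>(3)[symmetric]] by blast
    have "g \<bullet> v = (\<chi> j. a \<bullet> \<iota> (axis j 1)) \<bullet> u"
      unfolding g_def u by (rule norm_preserving_inner[OF \<iota>(1,2)])
    also have "\<dots> = a \<bullet> v"
      unfolding u linear_axis_expansion[OF \<iota>(1), of u]
      by (simp add: inner_vec_def[of _ u] inner_sum_right mult.commute)
    finally show ?thesis .
  qed
  have affine_deriv: "((\<lambda>y. g \<bullet> y + (f x - g \<bullet> x)) has_derivative (\<lambda>h. g \<bullet> h)) (at x within K)"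
    by (auto intro!: derivative_eq_intros)
  have f_eq: "f y = g \<bullet> y + (f x - g \<bullet> x)" if "y \<in> K" for y
  proof -
    have "y - x \<in> tangent_space K"
      using that xK by (auto simp: tangent_space_def intro!: span_base)
    then show ?thesis
      using inner_g[of "y - x"] f[OF that] f[OF xK] by (simp add: inner_diff_right)
  qed
  have deriv: "(f has_derivative (\<lambda>h. g \<bullet> h)) (at x within K)"
    by (rule has_derivative_transform[OF xK f_eq affine_deriv])
  have unique: "g' = g" if g': "g' \<in> tangent_space K" "(f has_derivative (\<lambda>h. g' \<bullet> h)) (at x within K)" for g'
  proof -
    \<comment> \<open>The difference of two candidates is itself tangential. Differentiating the
      zero function along the line through \<open>x\<close> in direction \<open>d\<close> gives
      \<open>d \<bullet> d = 0\<close>.\<close>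
    define d where "d = g' - g"
    have dT: "d \<in> tangent_space K"
      using g' gT by (simp add: d_def tangent_space_def span_diff)
    obtain e where e: "e > 0" "ball x e \<inter> affine hull K \<subseteq> K"
      using x by (auto simp: mem_rel_interior_ball)
    \<comment> \<open>Adding 1 to \<open>norm d\<close> keeps the denominator positive when
      \<open>d = 0\<close>.\<close>
    define r where "r = e / (norm d + 1)"
    have r: "r > 0"
      using e(1) by (simp add: r_def add_nonneg_pos)
    have line: "x + t *\<^sub>R d \<in> K" if "t \<in> {-r<..<r}" for t
    proof -
      have "t *\<^sub>R d \<in> span ((\<lambda>y. - x + y) ` K)"
        using dT tangent_space_eq_span[OF xK] by (simp add: span_mul)
      then have "x + t *\<^sub>R d \<in> affine hull K"
        using affine_hull_span_gen[of x K] xK by (simp add: hull_inc)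
      moreover have "norm (t *\<^sub>R d) < e"
      proof -
        have "norm (t *\<^sub>R d) \<le> \<bar>t\<bar> * (norm d + 1)"
          by (simp add: algebra_simps)
        also have "\<dots> < r * (norm d + 1)"
          using that by (intro mult_strict_right_mono) (auto simp: add_nonneg_pos)
        also have "\<dots> = e"
          using add_nonneg_pos[of "norm d" 1] by (simp add: r_def)
        finally show ?thesis .
      qed
      then have "x + t *\<^sub>R d \<in> ball x e"
        by (simp add: dist_norm)
      ultimately show ?thesis
        using e(2) by blast
    qed
    have "((\<lambda>y. f y - f y) has_derivative (\<lambda>h. g' \<bullet> h - g \<bullet> h)) (at x within K)"
      using g'(2) deriv by (rule has_derivative_diff)
    then have "((\<lambda>y. 0) has_derivative (\<lambda>h. d \<bullet> h)) (at x within K)"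
      by (simp add: d_def inner_diff_left)
    then have zero_deriv: "((\<lambda>y. 0::real) has_derivative (\<lambda>h. d \<bullet> h))
        (at (x + 0 *\<^sub>R d) within (\<lambda>t. x + t *\<^sub>R d) ` {-r<..<r})"
      unfolding scaleR_zero_left add_0_right using line by (rule has_derivative_subset[OF _ image_subsetI])
    have line_deriv: "((\<lambda>t. x + t *\<^sub>R d) has_derivative (\<lambda>t. t *\<^sub>R d)) (at 0 within {-r<..<r})"
      by (auto intro!: derivative_eq_intros)
    have "((\<lambda>t. 0::real) has_derivative (\<lambda>t. d \<bullet> (t *\<^sub>R d))) (at 0 within {-r<..<r})"
      by (rule has_derivative_in_compose[OF line_deriv zero_deriv])
    moreover have "at (0::real) within {-r<..<r} = at 0"
      using r by (intro at_within_open) auto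
    ultimately have "((\<lambda>t. 0::real) has_derivative (\<lambda>t. d \<bullet> (t *\<^sub>R d))) (at (0::real))"
      by (simp only:)
    then have "(\<lambda>t::real. d \<bullet> (t *\<^sub>R d)) = (\<lambda>t. 0)"
      by (rule has_derivative_unique) simp
    then have "d \<bullet> d = 0"
      by (auto dest: fun_cong[of _ _ 1])
    then show ?thesis
      by (simp add: d_def)
  qed
  show ?thesis
    unfolding tangential_grad_def g_def[symmetric]
  proof (rule the_equality)
    show "g \<in> tangent_space K \<and> (f has_derivative (\<bullet>) g) (at x within K)"
      using gT deriv by (rule conjI)
  qed (rule unique, erule conjunct1, erule conjunct2)
qed

section \<open>Area and Dirichlet energy on one simplex\<close>

lemma simplex_measure:
  fixes K :: "(real^'n) set"
  assumes card: "CARD('n) = CARD('k::finite) + 1" and K: "(int CARD('n) - 1) simplex K"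
  shows "emeasure (hausdorff_measure (CARD('n) - 1)) K < top" "area (rel_interior K) = area K"
proof -
  obtain \<iota> :: "real^'k \<Rightarrow> real^'n" and p B where \<iota>: "linear \<iota>" "\<And>x. norm (\<iota> x) = norm x"
    and B: "compact B" "convex B" and K_eq: "K = (\<lambda>x. p + \<iota> x) ` B"
    using simplex_chart[OF card K] by metis
  have borel: "K \<in> sets borel" "rel_interior K \<in> sets borel"
    using compact_imp_closed[OF compact_simplex[OF K]] by (auto intro: borel_rel_interior)
  have "hausdorff_outer CARD('k) K = hausdorff_outer CARD('k) B"
    unfolding K_eq by (rule hausdorff_outer_chart[OF \<iota>])
  then show "emeasure (hausdorff_measure (CARD('n) - 1)) K < top"
    using hausdorff_outer_bounded_finite[OF compact_imp_bounded[OF B(1)]] card borel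
    by (simp add: emeasure_hausdorff_measure)
  have "hausdorff_outer CARD('k) (rel_interior K) = hausdorff_outer CARD('k) (rel_interior B)"
    unfolding K_eq rel_interior_chart[OF \<iota>] by (rule hausdorff_outer_chart[OF \<iota>])
  also have "\<dots> = hausdorff_outer CARD('k) B"
    using B by (subst (1 2) hausdorff_outer_eq_lborel)
      (auto simp: emeasure_rel_interior_convex intro: borel_compact borel_rel_interior compact_imp_closed)
  also have "\<dots> = hausdorff_outer CARD('k) K"
    unfolding K_eq by (rule hausdorff_outer_chart[OF \<iota>, symmetric])
  finally show "area (rel_interior K) = area K"
    using borel by (simp add: area_eq_outer[OF card])
qed

lemma norm_vec_power2: "(norm v)\<^sup>2 = (\<Sum>i\<in>UNIV. (v $ i)\<^sup>2)" for v :: "real^'n"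
  unfolding power2_norm_eq_inner inner_vec_def by (simp add: power2_eq_square)

lemma inner_vec_lambda: "(\<chi> i. u i) \<bullet> (\<chi> i. v i) = (\<Sum>i\<in>UNIV. u i \<bullet> v i)"
  by (simp add: inner_vec_def)

text \<open>The gradients are constant on the relative interior, so their product is a number
  \<open>e\<close>, and the area ratio is a determinant bounded by \<open>1 + e\<close>. The
  determinant inequality is a hypothesis so that one argument serves both dimensions.\<close>

lemma simplex_energy:
  fixes K :: "(real^'n) set" and X :: "real^'n \<Rightarrow> real^'n"
  assumes card: "CARD('n) = CARD('k::{finite,wellorder}) + 1"
    and det_le: "\<And>M :: real^'k::_ \<Rightarrow> real^'k::_.
      2 * (\<bar>det (matrix M)\<bar> - 1) \<le> (\<Sum>j\<in>UNIV. (norm (M (axis j 1)))\<^sup>2) - CARD('k)"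
    and K: "(int CARD('n) - 1) simplex K"
    and cont: "\<And>i. continuous_on K (\<lambda>x. X x $ i)"
    and affine: "\<And>i. \<exists>a b. \<forall>x\<in>rel_interior K. X x $ i = a \<bullet> x + b"
  shows "\<exists>e. (\<forall>x\<in>rel_interior K. (\<chi> i. tangential_grad K (\<lambda>y. X y $ i) x) \<bullet>
        (\<chi> i. tangential_grad K (\<lambda>y. (X y - y) $ i) x) = e) \<and> area (X ` K) \<le> area K * (1 + e)"
proof -
  obtain \<iota> :: "real^'k::_ \<Rightarrow> real^'n" and p B where \<iota>: "linear \<iota>" "\<And>x. norm (\<iota> x) = norm x"
    "range \<iota> = tangent_space K" and B: "compact B" "convex B" and K_eq: "K = (\<lambda>x. p + \<iota> x) ` B"
    using simplex_chart[OF card K] by metis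
  obtain a b where ab: "\<And>i x. x \<in> rel_interior K \<Longrightarrow> X x $ i = a i \<bullet> x + b i"
    using affine by metis
  have clK: "closure (rel_interior K) = K"
    using convex_simplex[OF K] compact_simplex[OF K]
    by (simp add: convex_closure_rel_interior compact_imp_closed)
  \<comment> \<open>Affinity is given only on the relative interior; continuity extends it to all of
    \<open>K\<close>.\<close>
  have X_eq: "X x $ i = a i \<bullet> x + b i" if "x \<in> K" for x i
  proof -
    have "continuous_on (closure (rel_interior K)) (\<lambda>x. X x $ i - (a i \<bullet> x + b i))"
      unfolding clK by (intro continuous_intros cont)
    then have "X x $ i - (a i \<bullet> x + b i) = 0"
      by (rule continuous_constant_on_closure) (use that in \<open>auto simp: ab clK\<close>)
    then show ?thesis
      by simp
  qed
  define w where "w = (\<lambda>j. \<iota> (axis j 1))"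
  define e where "e = (\<Sum>i\<in>UNIV. \<Sum>j\<in>UNIV. (a i \<bullet> w j) * ((a i - axis i 1) \<bullet> w j))"
  \<comment> \<open>The linear part of \<open>X\<close> composed with the chart.\<close>
  define h where "h = (\<lambda>v. (\<chi> i. a i \<bullet> \<iota> v))"
  have "linear h"
    unfolding h_def using \<iota>(1)
    by (intro linearI) (simp_all add: linear_add linear_cmul inner_add_right vec_eq_iff)
  then obtain M :: "real^'k::_ \<Rightarrow> real^'k::_" where M: "\<And>x. norm (M x) = norm (h x)"
    "\<And>B p. compact B \<Longrightarrow> hausdorff_outer CARD('k) ((\<lambda>x. p + h x) ` B) =
       hausdorff_outer CARD('k) (cbox 0 One :: (real^'k::_) set) *
       ennreal (\<bar>det (matrix M)\<bar> * measure lebesgue B)"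
    using hausdorff_outer_linear_image[OF card] by metis
  define C where "C = hausdorff_outer CARD('k) (cbox 0 One :: (real^'k::_) set)"
  have image_X: "X ` K = (\<lambda>x. (\<chi> i. a i \<bullet> p + b i) + h x) ` B"
    unfolding K_eq image_image
  proof (rule image_cong)
    fix u assume "u \<in> B"
    then have "p + \<iota> u \<in> K"
      by (auto simp: K_eq)
    then show "X (p + \<iota> u) = (\<chi> i. a i \<bullet> p + b i) + h u"
      by (simp add: vec_eq_iff X_eq h_def inner_add_right)
  qed simp
  have "continuous_on K X"
    using continuous_on_vec_lambda[of K "\<lambda>i x. X x $ i"] cont by simp
  then have "compact (X ` K)"
    using compact_simplex[OF K] by (rule compact_continuous_image)
  then have "area (X ` K) = enn2real (hausdorff_outer CARD('k) (X ` K))"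
    by (simp add: area_eq_outer[OF card] borel_compact)
  also have "hausdorff_outer CARD('k) (X ` K) = C * ennreal (\<bar>det (matrix M)\<bar> * measure lebesgue B)"
    unfolding image_X C_def by (rule M(2)[OF B(1)])
  finally have area_X: "area (X ` K) = enn2real C * measure lebesgue B * \<bar>det (matrix M)\<bar>"
    by (simp add: enn2real_mult)
  have "area K = enn2real (hausdorff_outer CARD('k) K)"
    using compact_simplex[OF K] by (simp add: area_eq_outer[OF card] borel_compact)
  also have "hausdorff_outer CARD('k) K = hausdorff_outer CARD('k) B"
    unfolding K_eq by (rule hausdorff_outer_chart[OF \<iota>(1,2)])
  also have "\<dots> = C * emeasure lborel B"
    unfolding C_def using B by (intro hausdorff_outer_eq_lborel) (auto intro: borel_compact)
  also have "emeasure lborel B = ennreal (measure lebesgue B)"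
    using emeasure_compact_finite[OF B(1)] borel_compact[OF B(1)] by (simp add: emeasure_eq_ennreal_measure)
  finally have area_K: "area K = enn2real C * measure lebesgue B"
    by (simp add: enn2real_mult)
  \<comment> \<open>The vectors \<open>w j\<close> have norm 1, so \<open>CARD('k)\<close> is the
    squared norm of the identity on the tangent space.\<close>
  have "(\<Sum>j\<in>UNIV. (norm (M (axis j 1)))\<^sup>2) - CARD('k)
      = (\<Sum>j\<in>UNIV. (norm (h (axis j 1)))\<^sup>2 - (norm (w j))\<^sup>2)"
    by (simp add: sum_subtractf M w_def \<iota>)
  also have "\<dots> = (\<Sum>j\<in>UNIV. \<Sum>i\<in>UNIV. (a i \<bullet> w j)\<^sup>2 - (axis i 1 \<bullet> w j)\<^sup>2)"
    by (simp add: norm_vec_power2 h_def w_def sum_subtractf inner_axis')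
  also have "\<dots> \<le> (\<Sum>j\<in>UNIV. \<Sum>i\<in>UNIV. 2 * ((a i \<bullet> w j) * ((a i - axis i 1) \<bullet> w j)))"
  proof (intro sum_mono)
    \<comment> \<open>The two sides differ by the square of \<open>x - y\<close>, where
      \<open>x\<close> and \<open>y\<close> are the corresponding entries for \<open>X\<close> and
      for the identity.\<close>
    fix i j
    have "x\<^sup>2 - y\<^sup>2 \<le> 2 * (x * (x - y))" for x y :: real
      using zero_le_power2[of "x - y"] by (simp add: power2_diff power2_eq_square algebra_simps)
    then show "(a i \<bullet> w j)\<^sup>2 - (axis i 1 \<bullet> w j)\<^sup>2 \<le> 2 * ((a i \<bullet> w j) * ((a i - axis i 1) \<bullet> w j))"
      unfolding inner_diff_left .
  qed
  also have "\<dots> = 2 * e"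
    unfolding e_def sum_distrib_left by (rule sum.swap)
  finally have "2 * (\<bar>det (matrix M)\<bar> - 1) \<le> 2 * e"
    using det_le order_trans by blast
  then have "\<bar>det (matrix M)\<bar> \<le> 1 + e"
    by simp
  then have area_le: "area (X ` K) \<le> area K * (1 + e)"
    unfolding area_X area_K by (intro mult_left_mono) (simp_all add: measure_nonneg)
  have inner: "(\<chi> i. tangential_grad K (\<lambda>y. X y $ i) x) \<bullet>
        (\<chi> i. tangential_grad K (\<lambda>y. (X y - y) $ i) x) = e" if x: "x \<in> rel_interior K" for x
  proof -
    have "tangential_grad K (\<lambda>y. X y $ i) x = \<iota> (\<chi> j. a i \<bullet> w j)" for i
      unfolding w_def by (rule tangential_grad_affine[OF x \<iota> X_eq])
    moreover have "tangential_grad K (\<lambda>y. (X y - y) $ i) x = \<iota> (\<chi> j. (a i - axis i 1) \<bullet> w j)" for i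
      unfolding w_def
      by (rule tangential_grad_affine[OF x \<iota>, of _ _ "b i"]) (simp add: X_eq inner_diff_left inner_axis')
    ultimately show ?thesis
      by (simp only: inner_vec_lambda norm_preserving_inner[OF \<iota>(1,2)] inner_real_def e_def)
  qed
  show ?thesis
    by (intro exI[of _ e] conjI ballI inner area_le)
qed

subsection \<open>Polyhedral surfaces\<close>

text \<open>The intersection of two members is a face of each, and a face that meets the relative
  interior is the whole simplex.\<close>

lemma triangulation_rel_interior_disjoint:
  assumes "triangulation S" "K \<in> S" "L \<in> S" "x \<in> rel_interior K" "x \<in> rel_interior L"
  shows "K = L"
proof -
  have sub: "K \<subseteq> L" if "K \<in> S" "L \<in> S" "x \<in> rel_interior K" "x \<in> rel_interior L" for K L
  proof -
    have face: "K \<inter> L face_of K"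
      using assms(1) that by (simp add: triangulation_def)
    have "K \<inter> L \<inter> rel_interior K \<noteq> {}"
      using that rel_interior_subset[of K] rel_interior_subset[of L] by blast
    then have "K \<subseteq> K \<inter> L"
      by (rule subset_of_face_of[OF face subset_refl])
    then show ?thesis
      by simp
  qed
  show ?thesis
    by (rule antisym; rule sub; fact)
qed

text \<open>Only one term survives, by disjointness of the relative interiors. This evaluates
  \<open>normal\<close> and \<open>surface_grad\<close> away from the relative boundaries.\<close>

lemma sum_indicator_rel_interior:
  fixes g :: "'a::euclidean_space set \<Rightarrow> 'b::real_vector"
  assumes "triangulation S" "K \<in> S" "x \<in> rel_interior K"
  shows "(\<Sum>L\<in>S. indicator (rel_interior L) x *\<^sub>R g L) = g K"
proof -
  have "(\<Sum>L\<in>S. indicator (rel_interior L) x *\<^sub>R g L) = (\<Sum>L\<in>S. if L = K then g L else 0)"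
    using triangulation_rel_interior_disjoint[OF assms(1)] assms
    by (intro sum.cong) (auto simp: indicator_def)
  also have "\<dots> = g K"
    using assms by (simp add: triangulation_def)
  finally show ?thesis .
qed

text \<open>The bounds on single simplices are added up. The surface term is the integral of a step
  function with value \<open>e K\<close> on the relative interior of \<open>K\<close>.\<close>

lemma surface_energy:
  fixes S :: "(real^'n) set set" and X :: "real^'n \<Rightarrow> real^'n"
  assumes card: "CARD('n) = CARD('k::{finite,wellorder}) + 1"
    and det_le: "\<And>M :: real^'k::_ \<Rightarrow> real^'k::_.
      2 * (\<bar>det (matrix M)\<bar> - 1) \<le> (\<Sum>j\<in>UNIV. (norm (M (axis j 1)))\<^sup>2) - CARD('k)"
    and S: "triangulation S" "\<forall>K\<in>S. (int CARD('n) - 1) simplex K"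
    and X: "X \<in> V_space S"
  shows "area (X ` \<Union>S) \<le> area (\<Union>S) + surface_inner S (surface_grad S X) (surface_grad S (\<lambda>x. X x - x))"
proof -
  let ?H = "hausdorff_measure (CARD('n) - 1) :: (real^'n) measure"
  have finS: "finite S"
    using S(1) by (simp add: triangulation_def)
  have contX: "continuous_on (\<Union>S) (\<lambda>x. X x $ i)" for i
    using X by (auto simp: V_space_def W_space_def)
  define P where "P K e \<longleftrightarrow> (\<forall>x\<in>rel_interior K. (\<chi> i. tangential_grad K (\<lambda>y. X y $ i) x) \<bullet>
        (\<chi> i. tangential_grad K (\<lambda>y. (X y - y) $ i) x) = e) \<and> area (X ` K) \<le> area K * (1 + e)" for K e
  have "\<forall>K\<in>S. \<exists>e. P K e"
  proof
    fix K assume K: "K \<in> S"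
    show "\<exists>e. P K e"
      unfolding P_def
    proof (rule simplex_energy[OF card det_le])
      show "(int CARD('n) - 1) simplex K"
        using S(2) K by blast
      show "continuous_on K (\<lambda>x. X x $ i)" for i
        using contX K by (rule continuous_on_subset[OF _ Union_upper])
      show "\<exists>a b. \<forall>x\<in>rel_interior K. X x $ i = a \<bullet> x + b" for i
        using X K by (auto simp: V_space_def W_space_def)
    qed
  qed
  from bchoice[OF this] obtain e where "\<forall>K\<in>S. P K (e K)"
    by blast
  then have e: "\<And>K x. K \<in> S \<Longrightarrow> x \<in> rel_interior K \<Longrightarrow>
        (\<chi> i. tangential_grad K (\<lambda>y. X y $ i) x) \<bullet> (\<chi> i. tangential_grad K (\<lambda>y. (X y - y) $ i) x) = e K"
      and area_e: "\<And>K. K \<in> S \<Longrightarrow> area (X ` K) \<le> area K * (1 + e K)"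
    unfolding P_def by blast+
  have compK: "compact K" if "K \<in> S" for K
    using S(2) that compact_simplex by blast
  have borelK: "K \<in> sets borel" "rel_interior K \<in> sets borel" if "K \<in> S" for K
    using compK[OF that] by (auto intro: borel_compact borel_rel_interior compact_imp_closed)
  have finK: "emeasure ?H K < top" if "K \<in> S" for K
    using S(2) that simplex_measure(1)[OF card] by blast
  have finR: "emeasure ?H (rel_interior K) < top" if "K \<in> S" for K
  proof -
    have "emeasure ?H (rel_interior K) \<le> emeasure ?H K"
      using borelK[OF that] by (intro emeasure_mono rel_interior_subset) simp
    then show ?thesis
      using finK[OF that] by (rule le_less_trans)
  qed
  have finU: "emeasure ?H (\<Union>S) < top"
  proof -
    have "emeasure ?H (\<Union>K\<in>S. K) \<le> (\<Sum>K\<in>S. emeasure ?H K)"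
      using finS borelK by (intro emeasure_subadditive_finite) auto
    also have "\<dots> < top"
      using finS finK by simp
    finally show ?thesis
      by simp
  qed
  \<comment> \<open>The identity holds at every point: off the relative interiors
    \<open>surface_grad\<close> is zero by definition.\<close>
  have "indicator (\<Union>S) x *\<^sub>R (surface_grad S X x \<bullet> surface_grad S (\<lambda>x. X x - x) x)
      = (\<Sum>K\<in>S. indicator (rel_interior K) x *\<^sub>R e K)" for x
  proof (cases "\<exists>K\<in>S. x \<in> rel_interior K")
    case True
    then obtain K where K: "K \<in> S" "x \<in> rel_interior K"
      by blast
    moreover have "x \<in> \<Union>S"
      using K rel_interior_subset by blast
    ultimately show ?thesis
      by (simp only: surface_grad_def sum_indicator_rel_interior[OF S(1) K] e[OF K] indicator_simps scaleR_one)
  next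
    case False
    then show ?thesis
      by (simp add: surface_grad_def indicator_def)
  qed
  then have "surface_inner S (surface_grad S X) (surface_grad S (\<lambda>x. X x - x))
      = (\<integral>x. (\<Sum>K\<in>S. indicator (rel_interior K) x *\<^sub>R e K) \<partial>?H)"
    by (simp add: surface_inner_def set_lebesgue_integral_def)
  also have "\<dots> = (\<Sum>K\<in>S. area (rel_interior K) * e K)"
    using finR borelK by (subst Bochner_Integration.integral_sum) (auto simp: area_def)
  also have "\<dots> = (\<Sum>K\<in>S. area K * e K)"
    using S(2) simplex_measure(2)[OF card] by (intro sum.cong) auto
  finally have inner: "surface_inner S (surface_grad S X) (surface_grad S (\<lambda>x. X x - x))
      = (\<Sum>K\<in>S. area K * e K)" .
  have "continuous_on (\<Union>S) X"
    using continuous_on_vec_lambda[of "\<Union>S" "\<lambda>i x. X x $ i"] contX by simp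
  then have "X ` K \<in> sets borel" if "K \<in> S" for K
    using that
    by (intro borel_compact compact_continuous_image compK) (rule continuous_on_subset[OF _ Union_upper])
  \<comment> \<open>The images of different simplices may overlap, so subadditivity is used here; on
    the original surface the relative interiors are disjoint and their areas add up exactly.\<close>
  then have "area (\<Union>K\<in>S. X ` K) \<le> (\<Sum>K\<in>S. area (X ` K))"
    unfolding area_def using finS by (intro measure_UNION_le) auto
  also have "\<dots> \<le> (\<Sum>K\<in>S. area K * (1 + e K))"
    by (intro sum_mono area_e)
  also have "\<dots> = (\<Sum>K\<in>S. area K) + (\<Sum>K\<in>S. area K * e K)"
    by (simp add: distrib_left sum.distrib)
  also have "(\<Sum>K\<in>S. area K) = (\<Sum>K\<in>S. area (rel_interior K))"
    using S(2) simplex_measure(2)[OF card] by (intro sum.cong) auto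
  also have "\<dots> = area (\<Union>K\<in>S. rel_interior K)"
  proof -
    have "disjoint_family_on rel_interior S"
      unfolding disjoint_family_on_def using triangulation_rel_interior_disjoint[OF S(1)] by blast
    then show ?thesis
      unfolding area_def using finS borelK finR
      by (intro measure_finite_Union[symmetric]) (auto simp: less_top)
  qed
  also have "\<dots> \<le> area (\<Union>S)"
    unfolding area_def
  proof (rule measure_mono_fmeasurable)
    show "(\<Union>K\<in>S. rel_interior K) \<subseteq> \<Union>S"
      using rel_interior_subset by blast
    show "(\<Union>K\<in>S. rel_interior K) \<in> sets ?H"
      using finS borelK by auto
    show "\<Union>S \<in> fmeasurable ?H"
      using finS borelK finU by (intro fmeasurableI) (auto intro!: sets.finite_Union)
  qed
  finally show ?thesis
    by (simp add: inner image_Union)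
qed

text \<open>The limits must be shown to exist along a nontrivial filter: otherwise \<^const>\<open>Lim\<close> is an
  unspecified value that does not scale.\<close>

lemma lumped_inner_scale:
  fixes S :: "(real^'n) set set" and Y :: "real^'n \<Rightarrow> real^'n"
  assumes n: "CARD('n) \<ge> 2" and S: "triangulation S" "\<forall>K\<in>S. (int CARD('n) - 1) simplex K"
    and Y: "continuous_on (\<Union>S) Y" and \<kappa>: "continuous_on (\<Union>S) \<kappa>"
  shows "lumped_inner S (\<lambda>x. Y x /\<^sub>R \<tau>) (\<lambda>x. \<kappa> x *\<^sub>R normal S x)
    = lumped_inner S (\<lambda>x. \<kappa> x *\<^sub>R normal S x) Y / \<tau>"
proof -
  have "Lim (at q within rel_interior K) (\<lambda>x. (Y x /\<^sub>R \<tau>) \<bullet> (\<kappa> x *\<^sub>R normal S x))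
      = Lim (at q within rel_interior K) (\<lambda>x. (\<kappa> x *\<^sub>R normal S x) \<bullet> Y x) / \<tau>"
    if K: "K \<in> S" and q: "q extreme_point_of K" for K q
  proof -
    let ?F = "at q within rel_interior K"
    have simp_K: "(int CARD('n) - 1) simplex K"
      using S(2) K by blast
    have convK: "convex K" and qK: "q \<in> K"
      using convex_simplex[OF simp_K] q by (auto simp: extreme_point_of_def)
    \<comment> \<open>Since \<open>CARD('n) \<ge> 2\<close>, the simplex has dimension at least 1,
      so the vertex \<open>q\<close> is an accumulation point and the limit is unique.\<close>
    have "K \<noteq> {q}"
      using aff_dim_simplex[OF simp_K] n by auto
    then have "q islimpt K"
      using convK qK by (intro connected_imp_perfect) (auto simp: convex_connected)
    then have "q islimpt closure (rel_interior K)"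
      using convK closure_subset islimpt_subset by (metis convex_closure_rel_interior)
    then have nontriv: "?F \<noteq> bot"
      by (simp add: trivial_limit_within limpt_of_closure)
    have lim: "(f \<longlongrightarrow> f q) ?F" if "continuous_on (\<Union>S) f" for f :: "real^'n \<Rightarrow> 'b::topological_space"
    proof -
      have "(f \<longlongrightarrow> f q) (at q within \<Union>S)"
        using that qK K by (auto simp: continuous_on_def)
      then show ?thesis
        using K rel_interior_subset[of K] by (elim tendsto_within_subset) blast
    qed
    \<comment> \<open>Within one relative interior the normal is constant, so the one-sided limit at
      a vertex exists even though \<open>normal\<close> may jump there.\<close>
    have norm_K: "\<forall>\<^sub>F x in ?F. normal S x = simplex_normal S K"
      unfolding normal_def eventually_at_filter
      by (intro always_eventually) (simp add: sum_indicator_rel_interior[OF S(1) K])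
    have "((\<lambda>x. (\<kappa> x *\<^sub>R simplex_normal S K) \<bullet> Y x) \<longlongrightarrow> (\<kappa> q *\<^sub>R simplex_normal S K) \<bullet> Y q) ?F"
      by (intro tendsto_inner tendsto_scaleR tendsto_const lim Y \<kappa>)
    then have 1: "((\<lambda>x. (\<kappa> x *\<^sub>R normal S x) \<bullet> Y x) \<longlongrightarrow> (\<kappa> q *\<^sub>R simplex_normal S K) \<bullet> Y q) ?F"
      by (rule Lim_transform_eventually) (use norm_K in \<open>auto elim: eventually_mono\<close>)
    then have "((\<lambda>x. (\<kappa> x *\<^sub>R normal S x) \<bullet> Y x / \<tau>) \<longlongrightarrow> (\<kappa> q *\<^sub>R simplex_normal S K) \<bullet> Y q / \<tau>) ?F"
      unfolding divide_inverse by (rule tendsto_mult_right)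
    then have "((\<lambda>x. (Y x /\<^sub>R \<tau>) \<bullet> (\<kappa> x *\<^sub>R normal S x)) \<longlongrightarrow> (\<kappa> q *\<^sub>R simplex_normal S K) \<bullet> Y q / \<tau>) ?F"
      by (simp add: inner_commute divide_inverse mult_ac)
    then show ?thesis
      using 1 nontriv by (simp add: tendsto_Lim)
  qed
  then have "lumped_inner S (\<lambda>x. Y x /\<^sub>R \<tau>) (\<lambda>x. \<kappa> x *\<^sub>R normal S x) =
    1 / real CARD('n) * (\<Sum>K\<in>S. area (rel_interior K) *
        (\<Sum>q | q extreme_point_of K. Lim (at q within rel_interior K) (\<lambda>x. (\<kappa> x *\<^sub>R normal S x) \<bullet> Y x) / \<tau>))"
    unfolding lumped_inner_def by (intro arg_cong2[where f = "(*)"] sum.cong refl) auto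
  also have "\<dots> = lumped_inner S (\<lambda>x. \<kappa> x *\<^sub>R normal S x) Y / \<tau>"
    by (simp only: lumped_inner_def sum_divide_distrib[symmetric] times_divide_eq_right)
  finally show ?thesis .
qed

section \<open>Test functions and the discrete energy estimate\<close>

text \<open>Together with closure under differences, this makes the displacement
  \<open>X x - x\<close> an admissible test function in the curvature equation.\<close>

lemma identity_in_W_space:
  fixes S :: "(real^'n) set set"
  shows "(\<lambda>x. x $ i) \<in> W_space S"
  unfolding W_space_def
  by (intro CollectI conjI ballI exI[of _ "axis i 1"] exI[of _ 0] continuous_on_component continuous_on_id)
    (simp add: inner_axis')

lemma W_space_diff:
  assumes "f \<in> W_space S" "g \<in> W_space S"
  shows "(\<lambda>x. f x - g x) \<in> W_space S"
  unfolding W_space_def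
proof (intro CollectI conjI ballI)
  show "continuous_on (\<Union>S) (\<lambda>x. f x - g x)"
    using assms by (intro continuous_on_diff) (auto simp: W_space_def)
  fix K assume "K \<in> S"
  then obtain a b c d where "\<forall>x\<in>rel_interior K. f x = a \<bullet> x + b" "\<forall>x\<in>rel_interior K. g x = c \<bullet> x + d"
    using assms unfolding W_space_def by blast
  then have "\<forall>x\<in>rel_interior K. f x - g x = (a - c) \<bullet> x + (b - d)"
    by (simp add: inner_diff_left)
  then show "\<exists>a b. \<forall>x\<in>rel_interior K. f x - g x = a \<bullet> x + b"
    by blast
qed

text \<open>The tangent dimension is represented by the type \<open>1\<close> or \<open>2\<close>,
  for which the matching determinant inequality is available.\<close>

lemma surface_energy_2_3:
  fixes S :: "(real^'n) set set" and X :: "real^'n \<Rightarrow> real^'n"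
  assumes dim: "CARD('n) = 2 \<or> CARD('n) = 3" and S: "closed_polyhedral_surface S" and X: "X \<in> V_space S"
  shows "area (X ` \<Union>S) \<le> area (\<Union>S) + surface_inner S (surface_grad S X) (surface_grad S (\<lambda>x. X x - x))"
  using dim
proof
  assume "CARD('n) = 2"
  then have "CARD('n) = CARD(1) + 1"
    by simp
  then show ?thesis
    using S X by (intro surface_energy[OF _ det_le_energy_1]) (auto simp: closed_polyhedral_surface_def)
next
  assume "CARD('n) = 3"
  then have "CARD('n) = CARD(2) + 1"
    by simp
  then show ?thesis
    using S X by (intro surface_energy[OF _ det_le_energy_2]) (auto simp: closed_polyhedral_surface_def)
qed

text \<open>The three tested equations eliminate the lumped product and the coupling term, leaving
  an exact energy balance. The surface bound then turns it into an inequality.\<close>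

lemma reduced_solution_stable:
  fixes \<Omega> :: "(real^'n) set"
  assumes dim: "CARD('n) = 2 \<or> CARD('n) = 3" and S: "closed_polyhedral_surface S"
    and pos: "\<gamma> > 0" "\<tau> > 0"
    and sol: "reduced_solution \<Omega> \<T> \<U> \<P> S \<gamma> \<mu> \<tau> F U X \<kappa>"
  shows "\<gamma> * area (X ` \<Union>S) + 2 * \<tau> * L2_inner \<Omega> (\<lambda>x. \<mu> x *\<^sub>R rate_of_strain \<Omega> U x) (rate_of_strain \<Omega> U)
    \<le> \<gamma> * area (\<Union>S) + \<tau> * L2_inner \<Omega> F U"
proof -
  let ?D = "L2_inner \<Omega> (\<lambda>x. \<mu> x *\<^sub>R rate_of_strain \<Omega> U x) (rate_of_strain \<Omega> U)"
  let ?\<nu> = "\<lambda>x. \<kappa> x *\<^sub>R normal S x"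
  let ?Y = "\<lambda>x. X x - x"
  let ?E = "surface_inner S (surface_grad S X) (surface_grad S ?Y)"
  have spaces: "U \<in> div_free_space \<Omega> \<U> \<P>" "X \<in> V_space S" "\<kappa> \<in> W_space S"
    using sol by (auto simp: reduced_solution_def)
  have Y: "?Y \<in> V_space S"
    using spaces(2) by (auto simp: V_space_def intro: W_space_diff identity_in_W_space)
  have momentum: "2 * ?D - \<gamma> * surface_inner S ?\<nu> U = L2_inner \<Omega> F U"
    using sol spaces(1) by (auto simp: reduced_solution_def)
  have kinematic: "lumped_inner S (\<lambda>x. ?Y x /\<^sub>R \<tau>) ?\<nu> = surface_inner S U ?\<nu>"
    using sol spaces(3) by (auto simp: reduced_solution_def)
  have curvature: "lumped_inner S ?\<nu> ?Y = - ?E"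
    using sol Y by (fastforce simp: reduced_solution_def)
  have "continuous_on (\<Union>S) (\<lambda>x. \<chi> i. ?Y x $ i)"
    using Y by (intro continuous_on_vec_lambda) (auto simp: V_space_def W_space_def)
  then have "continuous_on (\<Union>S) ?Y"
    by (simp only: vec_lambda_eta)
  moreover have "continuous_on (\<Union>S) \<kappa>"
    using spaces(3) by (simp add: W_space_def)
  moreover have "CARD('n) \<ge> 2"
    using dim by auto
  ultimately have "lumped_inner S (\<lambda>x. ?Y x /\<^sub>R \<tau>) ?\<nu> = lumped_inner S ?\<nu> ?Y / \<tau>"
    using S by (intro lumped_inner_scale) (auto simp: closed_polyhedral_surface_def)
  moreover have "surface_inner S ?\<nu> U = surface_inner S U ?\<nu>"
    by (simp add: surface_inner_def inner_commute)
  \<comment> \<open>Both tested surface equations contain the same lumped product, up to the factor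
    \<open>\<tau>\<close>, so it drops out.\<close>
  ultimately have "surface_inner S ?\<nu> U = - ?E / \<tau>"
    using kinematic curvature by simp
  then have "\<tau> * L2_inner \<Omega> F U = 2 * \<tau> * ?D + \<gamma> * ?E"
    using momentum pos by (simp add: field_simps)
  moreover have "\<gamma> * area (X ` \<Union>S) \<le> \<gamma> * (area (\<Union>S) + ?E)"
    using surface_energy_2_3[OF dim S spaces(2)] pos by (intro mult_left_mono) auto
  ultimately show ?thesis
    by (simp add: distrib_left)
qed

theorem theorem2:
  fixes \<Omega> :: "(real^'n) set" and M :: nat and t :: "nat \<Rightarrow> real" and T :: real
    and \<gamma> \<mu>\<^sub>m \<mu>\<^sub>p :: real
    and f :: "real \<Rightarrow> real^'n \<Rightarrow> real^'n" and F :: "nat \<Rightarrow> real^'n \<Rightarrow> real^'n"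
    and \<T> S :: "nat \<Rightarrow> (real^'n) set set"
    and \<U> :: "nat \<Rightarrow> (real^'n \<Rightarrow> real^'n) set" and \<P> :: "nat \<Rightarrow> (real^'n \<Rightarrow> real) set"
    and \<tau> :: "nat \<Rightarrow> real" and \<mu> :: "nat \<Rightarrow> real^'n \<Rightarrow> real"
  assumes dim: "CARD('n) = 2 \<or> CARD('n) = 3"
    and domain: "polyhedral_domain \<Omega>"
    and time: "t 0 = 0" "t M = T" "\<forall>m<M. t m < t (Suc m)" "\<forall>m<M. \<tau> m = t (Suc m) - t m"
    and params: "\<gamma> > 0" "\<mu>\<^sub>m > 0" "\<mu>\<^sub>p > 0"
    and mesh: "\<forall>m<M. regular_partitioning \<Omega> (\<T> m)"
    and spaces: "\<forall>m<M. velocity_space \<Omega> (\<T> m) (\<U> m)" "\<forall>m<M. pressure_space \<Omega> (\<T> m) (\<P> m)"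
    and surface: "\<forall>m<M. closed_polyhedral_surface (S m) \<and> \<Union>(S m) \<subseteq> closure \<Omega>"
    and viscosity: "\<forall>m<M. \<mu> m = viscosity \<Omega> (\<T> m) (S m) \<mu>\<^sub>m \<mu>\<^sub>p"
    and forcing: "\<forall>m<M. quadratic_interpolant \<Omega> (\<T> m) (f (t (Suc m))) (F (Suc m))"
  shows
    "(\<forall>m<M. \<forall>U X \<kappa>.
        unique_reduced_solution \<Omega> (\<T> m) (\<U> m) (\<P> m) (S m) \<gamma> (\<mu> m) (\<tau> m) (F (Suc m)) U X \<kappa> \<longrightarrow>
        \<gamma> * area (X ` \<Union>(S m))
          + 2 * \<tau> m * L2_inner \<Omega> (\<lambda>x. \<mu> m x *\<^sub>R rate_of_strain \<Omega> U x) (rate_of_strain \<Omega> U)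
        \<le> \<gamma> * area (\<Union>(S m)) + \<tau> m * L2_inner \<Omega> (F (Suc m)) U)
     \<and>
     (\<forall>U X \<kappa>.
        (\<forall>k<M. unique_reduced_solution \<Omega> (\<T> k) (\<U> k) (\<P> k) (S k) \<gamma> (\<mu> k) (\<tau> k) (F (Suc k))
                  (U (Suc k)) (X (Suc k)) (\<kappa> (Suc k))) \<and>
        (\<forall>k. Suc k < M \<longrightarrow> \<Union>(S (Suc k)) = X (Suc k) ` \<Union>(S k)) \<longrightarrow>
        (\<forall>m<M.
           \<gamma> * area (X (Suc m) ` \<Union>(S m))
             + 2 * (\<Sum>k\<le>m. \<tau> k * L2_inner \<Omega>
                      (\<lambda>x. \<mu> k x *\<^sub>R rate_of_strain \<Omega> (U (Suc k)) x) (rate_of_strain \<Omega> (U (Suc k))))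
           \<le> \<gamma> * area (\<Union>(S 0)) + (\<Sum>k\<le>m. \<tau> k * L2_inner \<Omega> (F (Suc k)) (U (Suc k)))))"
proof (intro conjI allI impI)
  have tau: "\<tau> k > 0" if "k < M" for k
    using time(3,4) that by simp
  have step: "\<gamma> * area (X ` \<Union>(S k))
          + 2 * \<tau> k * L2_inner \<Omega> (\<lambda>x. \<mu> k x *\<^sub>R rate_of_strain \<Omega> U x) (rate_of_strain \<Omega> U)
        \<le> \<gamma> * area (\<Union>(S k)) + \<tau> k * L2_inner \<Omega> (F (Suc k)) U"
    if "k < M"
      and "unique_reduced_solution \<Omega> (\<T> k) (\<U> k) (\<P> k) (S k) \<gamma> (\<mu> k) (\<tau> k) (F (Suc k)) U X \<kappa>"
    for k U X \<kappa>
    using that surface params(1) tau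
    by (intro reduced_solution_stable[OF dim]) (auto simp: unique_reduced_solution_def)
  show "\<gamma> * area (X ` \<Union>(S m))
          + 2 * \<tau> m * L2_inner \<Omega> (\<lambda>x. \<mu> m x *\<^sub>R rate_of_strain \<Omega> U x) (rate_of_strain \<Omega> U)
        \<le> \<gamma> * area (\<Union>(S m)) + \<tau> m * L2_inner \<Omega> (F (Suc m)) U"
    if "m < M"
      and "unique_reduced_solution \<Omega> (\<T> m) (\<U> m) (\<P> m) (S m) \<gamma> (\<mu> m) (\<tau> m) (F (Suc m)) U X \<kappa>"
    for m U X \<kappa>
    using that by (rule step)
  fix U X \<kappa> m
  assume sol: "(\<forall>k<M. unique_reduced_solution \<Omega> (\<T> k) (\<U> k) (\<P> k) (S k) \<gamma> (\<mu> k) (\<tau> k) (F (Suc k))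
                  (U (Suc k)) (X (Suc k)) (\<kappa> (Suc k))) \<and>
        (\<forall>k. Suc k < M \<longrightarrow> \<Union>(S (Suc k)) = X (Suc k) ` \<Union>(S k))" and "m < M"
  let ?D = "\<lambda>k. L2_inner \<Omega> (\<lambda>x. \<mu> k x *\<^sub>R rate_of_strain \<Omega> (U (Suc k)) x) (rate_of_strain \<Omega> (U (Suc k)))"
  have energy: "\<gamma> * area (X (Suc k) ` \<Union>(S k)) + 2 * \<tau> k * ?D k
      \<le> \<gamma> * area (\<Union>(S k)) + \<tau> k * L2_inner \<Omega> (F (Suc k)) (U (Suc k))" if "k < M" for k
    using sol that by (intro step) auto
  show "\<gamma> * area (X (Suc m) ` \<Union>(S m)) + 2 * (\<Sum>k\<le>m. \<tau> k * ?D k)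
      \<le> \<gamma> * area (\<Union>(S 0)) + (\<Sum>k\<le>m. \<tau> k * L2_inner \<Omega> (F (Suc k)) (U (Suc k)))"
    using \<open>m < M\<close>
  proof (induction m)
    case 0
    then show ?case
      using energy[of 0] by simp
  next
    case (Suc m)
    \<comment> \<open>The surface reached at one level is the starting surface of the next as a set,
      so the area terms telescope.\<close>
    have "\<Union>(S (Suc m)) = X (Suc m) ` \<Union>(S m)"
      using sol Suc.prems by blast
    then show ?case
      using energy[OF Suc.prems] Suc.IH Suc.prems by simp
  qed
qed

end
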